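(* Let $N\geq 2$, $d\geq 1$ and $i\geq 2$ be integers such that $N=\frac{d(d+i)}{i-1}$. Let $k\in\{d,\dots,d+i-1\}$ and let $\alpha,\beta\in X_{N,d,i,k}$ with $\alpha<\beta$ be arbitrary. Moreover, let $T_\alpha^2(\alpha)\in I_k^{o}(\alpha)$, $T_\alpha^2(\alpha+1)\in I_{k+1}^{o}(\alpha)$, $T_\beta^2(\beta)\in I_k^{o}(\beta)$ and $T_\beta^2(\beta+1)\in I_{k+1}^{o}(\beta)$. Put $A_0=[\alpha,\beta]\times[A,D]$, $A_1=\mathcal T_\alpha(A_0)$, $A_2=\mathcal T_\alpha(A_1)$, and $D_0=[\alpha+1,\beta+1]\times[C,F]$, $D_1=\mathcal T_\beta(D_0)$, $D_2=\mathcal T_\beta(D_1)$. Then $$\mathcal T_\alpha(A_2)=\mathcal T_\beta(D_2),$$ and the map $\mathcal M_{\beta,\alpha}:\Omega_\beta\to\Omega_\alpha$ defined by $$\mathcal M_{\beta,\alpha}(x,y)=\begin{cases}(x,y), & (x,y)\in\Omega_\beta\setminus(D_0\cup D_1\cup D_2),\\ \mathcal T_\alpha^{-3}\big(\mathcal T_\beta^3(x,y)\big), & (x,y)\in D_0,\\ \mathcal T_\alpha^{-2}\big(\mathcal T_\beta^2(x,y)\big), & (x,y)\in D_1,\\ \mathcal T_\alpha^{-1}\big(\mathcal T_\beta(x,y)\big), & (x,y)\in D_2,\end{cases}$$ is a metric isomorphism from $\Omega_\beta$ to $\Omega_\alpha$ (that is, from $(\Omega_\beta,\bar{\mathcal B}_\beta,\bar\mu_\beta,\mathcal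 T_\beta)$ to $(\Omega_\alpha,\bar{\mathcal B}_\alpha,\bar\mu_\alpha,\mathcal T_\alpha)$).
   Context: For an integer $N\ge 2$ and a real $\alpha$ with $0<\alpha\le\sqrt N-1$, put $I_\alpha=[\alpha,\alpha+1]$ and define $T_\alpha:I_\alpha\to[\alpha,\alpha+1)$ by $T_\alpha(x)=\frac Nx-d(x)$, where $d(x)=d_\alpha(x)=\lfloor \frac Nx-\alpha\rfloor$ (the dependence on $N$ is suppressed). The values of $d(\cdot)$ are the digits; they form a finite set of consecutive integers $\{d,d+1,\dots,d+i\}$ with smallest digit $d=d(\alpha+1)$ and largest digit $d+i$. The cylinders are $I_k=I_k(\alpha)=\{x\in I_\alpha : d(x)=k\}$; the largest digit is always chosen so that every cylinder is an interval (in the exceptional case that $N/\alpha-\alpha$ is an integer, the single point $\alpha$ is given the digit $N/\alpha-\alpha-1$, so that $T_\alpha(\alpha)=\alpha+1$). The interior of $I_k(\alpha)$ is denoted $I_k^{o}(\alpha)$. For positive integers $d,i$, let $\mathcal A_{N,d,i}$ be the set of all $\alpha\in(0,\sqrt N-1]$ for which $T_\alpha$ has digit set $\{d,d+1,\dots,d+i\}$; let $X_{N,d,i}=\{\alpha\in\mathcal A_{N,d,i} : T_\alpha(\alpha)\in I_d^{o}(\alpha),\ T_\alpha(\alpha+1)\in I_{d+i}^{o}(\alpha)\}$, and for $k=d,\dots,d+i-1$ let $X_{N,d,i,k}=\{\alpha\in X_{N,d,i} : T_\alpha^2(\alpha)\in I_k(\alpha),\ T_\alpha^2(\alpha+1)\in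 I_{k+1}(\alpha)\}$. Put $A=\frac{-(d+i+1)+\sqrt{(d+i+1)^2+4N}}{2}$, $E=A+1$, $B=\frac{-(d+1)+\sqrt{(d-1)^2+4N}}{2}$, $F=B+1$, $C=\frac{N(-(d+i-1)+\sqrt{(d+i+1)^2+4N})}{2(d+i+N)}$, $D=\frac{N(-(d+1)+\sqrt{(d-1)^2+4N})}{2(N-d)}$. For $\alpha\in X_{N,d,i}$, $\Omega_\alpha$ is the polygon bounded by the straight line segments between the vertices (in clockwise order) $(\alpha,A)$, $(T_\alpha^2(\alpha+1),A)$, $(T_\alpha^2(\alpha+1),B)$, $(T_\alpha(\alpha),B)$, $(T_\alpha(\alpha),C)$, $(\alpha+1,C)$, $(\alpha+1,F)$, $(T_\alpha^2(\alpha),F)$, $(T_\alpha^2(\alpha),E)$, $(T_\alpha(\alpha+1),E)$, $(T_\alpha(\alpha+1),D)$, $(\alpha,D)$, and back to $(\alpha,A)$. The map $\mathcal T_\alpha$ is $\mathcal T_\alpha(x,y)=\left(T_\alpha(x),\frac{N}{d_\alpha(x)+y}\right)$; it is an almost surely bijective map $\Omega_\alpha\to\Omega_\alpha$, and $\mathcal T_\alpha^{-1}$ denotes its (a.s. defined) inverse on $\Omega_\alpha$. $\bar{\mathcal B}_\alpha$ is the Borel $\sigma$-algebra of $\Omega_\alpha$ and $\bar\mu_\alpha$ is the $\mathcal T_\alpha$-invariant probability measure on $\Omega_\alpha$ with density $H\frac{N}{(N+xy)^2}\mathbf 1_{\Omega_\alpha}(x,y)$, $H$ the normalising constant. The same notation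 with $\beta$ in place of $\alpha$ is used. A metric isomorphism is a measure-preserving, almost surely bijective map intertwining the two transformations almost everywhere.
   Formalization: It is additionally assumed that A_0 ⊆ Ω_α and D_0 ⊆ Ω_β (otherwise the claim fails), and the equality T_α(A_2) = T_β(D_2) is exact when T_β²(β) ≠ α+1 and holds up to a Lebesgue null set when T_β²(β) = α+1. *)

theory Defs
  imports "HOL-Analysis.Analysis"
begin

section \<open>The interval map and its cylinders\<close>

text \<open>If \<open>N / \<alpha> - \<alpha>\<close> is an integer, the single point \<open>\<alpha>\<close> gets the digit of its right
  neighbours, so that the corresponding cylinder is not a point and \<open>\<alpha>\<close> is mapped to \<open>\<alpha> + 1\<close>.\<close>

definition digit :: "int \<Rightarrow> real \<Rightarrow> real \<Rightarrow> int" where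
  "digit N \<alpha> x =
     (if x = \<alpha> \<and> of_int N / \<alpha> - \<alpha> \<in> \<int>
      then \<lfloor>of_int N / \<alpha> - \<alpha>\<rfloor> - 1
      else \<lfloor>of_int N / x - \<alpha>\<rfloor>)"

definition T :: "int \<Rightarrow> real \<Rightarrow> real \<Rightarrow> real" where
  "T N \<alpha> x = of_int N / x - of_int (digit N \<alpha> x)"

definition cylinder :: "int \<Rightarrow> real \<Rightarrow> int \<Rightarrow> real set" where
  "cylinder N \<alpha> k = {x \<in> {\<alpha>..\<alpha> + 1}. digit N \<alpha> x = k}"

definition digit_params :: "int \<Rightarrow> int \<Rightarrow> int \<Rightarrow> real set" where
  "digit_params N d i =
     {\<alpha>. 0 < \<alpha> \<and> \<alpha> \<le> sqrt (of_int N) - 1 \<and> digit N \<alpha> ` {\<alpha>..\<alpha> + 1} = {d..d + i}}"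

definition X :: "int \<Rightarrow> int \<Rightarrow> int \<Rightarrow> real set" where
  "X N d i = {\<alpha> \<in> digit_params N d i.
     T N \<alpha> \<alpha> \<in> interior (cylinder N \<alpha> d) \<and>
     T N \<alpha> (\<alpha> + 1) \<in> interior (cylinder N \<alpha> (d + i))}"

definition Xk :: "int \<Rightarrow> int \<Rightarrow> int \<Rightarrow> int \<Rightarrow> real set" where
  "Xk N d i k = {\<alpha> \<in> X N d i.
     T N \<alpha> (T N \<alpha> \<alpha>) \<in> cylinder N \<alpha> k \<and>
     T N \<alpha> (T N \<alpha> (\<alpha> + 1)) \<in> cylinder N \<alpha> (k + 1)}"


section \<open>The planar domain\<close>

definition hA :: "int \<Rightarrow> int \<Rightarrow> int \<Rightarrow> real" where
  "hA N d i = (- of_int (d + i + 1) + sqrt ((of_int (d + i + 1))\<^sup>2 + 4 * of_int N)) / 2"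

definition hB :: "int \<Rightarrow> int \<Rightarrow> real" where
  "hB N d = (- of_int (d + 1) + sqrt ((of_int (d - 1))\<^sup>2 + 4 * of_int N)) / 2"

definition hC :: "int \<Rightarrow> int \<Rightarrow> int \<Rightarrow> real" where
  "hC N d i =
     of_int N * (- of_int (d + i - 1) + sqrt ((of_int (d + i + 1))\<^sup>2 + 4 * of_int N))
       / (2 * of_int (d + i + N))"

definition hD :: "int \<Rightarrow> int \<Rightarrow> real" where
  "hD N d =
     of_int N * (- of_int (d + 1) + sqrt ((of_int (d - 1))\<^sup>2 + 4 * of_int N))
       / (2 * of_int (N - d))"

definition hE :: "int \<Rightarrow> int \<Rightarrow> int \<Rightarrow> real" where
  "hE N d i = hA N d i + 1"

definition hF :: "int \<Rightarrow> int \<Rightarrow> real" where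
  "hF N d = hB N d + 1"

definition polygon_boundary :: "'a::real_normed_vector list \<Rightarrow> 'a set" where
  "polygon_boundary vs =
     (\<Union>j<length vs. closed_segment (vs ! j) (vs ! (Suc j mod length vs)))"

definition polygon_region :: "'a::real_normed_vector list \<Rightarrow> 'a set" where
  "polygon_region vs = polygon_boundary vs \<union> inside (polygon_boundary vs)"

definition \<Omega> :: "int \<Rightarrow> int \<Rightarrow> int \<Rightarrow> real \<Rightarrow> (real \<times> real) set" where
  "\<Omega> N d i \<alpha> = polygon_region
     [(\<alpha>, hA N d i), (T N \<alpha> (T N \<alpha> (\<alpha> + 1)), hA N d i),
      (T N \<alpha> (T N \<alpha> (\<alpha> + 1)), hB N d), (T N \<alpha> \<alpha>, hB N d),
      (T N \<alpha> \<alpha>, hC N d i), (\<alpha> + 1, hC N d i),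
      (\<alpha> + 1, hF N d), (T N \<alpha> (T N \<alpha> \<alpha>), hF N d),
      (T N \<alpha> (T N \<alpha> \<alpha>), hE N d i), (T N \<alpha> (\<alpha> + 1), hE N d i),
      (T N \<alpha> (\<alpha> + 1), hD N d), (\<alpha>, hD N d)]"


section \<open>The natural extension\<close>

definition TT :: "int \<Rightarrow> real \<Rightarrow> real \<times> real \<Rightarrow> real \<times> real" where
  "TT N \<alpha> = (\<lambda>(x, y). (T N \<alpha> x, of_int N / (of_int (digit N \<alpha> x) + y)))"

text \<open>\<open>TT N \<alpha>\<close> is bijective on \<open>\<Omega> N d i \<alpha>\<close> only up to null sets. Where a point has several
  preimages in \<open>\<Omega> N d i \<alpha>\<close>, an arbitrary one is chosen; where it has none, the value is
  unspecified.\<close>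

definition TT_inv :: "int \<Rightarrow> int \<Rightarrow> int \<Rightarrow> real \<Rightarrow> real \<times> real \<Rightarrow> real \<times> real" where
  "TT_inv N d i \<alpha> = inv_into (\<Omega> N d i \<alpha>) (TT N \<alpha>)"

definition kernel :: "int \<Rightarrow> real \<times> real \<Rightarrow> real" where
  "kernel N = (\<lambda>(x, y). of_int N / (of_int N + x * y)\<^sup>2)"

definition norm_const :: "int \<Rightarrow> int \<Rightarrow> int \<Rightarrow> real \<Rightarrow> real" where
  "norm_const N d i \<alpha> = 1 / set_lebesgue_integral lborel (\<Omega> N d i \<alpha>) (kernel N)"

definition mu :: "int \<Rightarrow> int \<Rightarrow> int \<Rightarrow> real \<Rightarrow> (real \<times> real) measure" where
  "mu N d i \<alpha> = density (restrict_space lborel (\<Omega> N d i \<alpha>))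
     (\<lambda>p. ennreal (norm_const N d i \<alpha> * kernel N p))"


section \<open>Metric isomorphisms\<close>

text \<open>The map \<open>\<phi>\<close> matters only up to null sets: its restriction to a set of full measure is a
  bimeasurable, measure-preserving bijection onto a set of full measure.\<close>

definition metric_isomorphism ::
  "'a measure \<Rightarrow> ('a \<Rightarrow> 'a) \<Rightarrow> 'b measure \<Rightarrow> ('b \<Rightarrow> 'b) \<Rightarrow> ('a \<Rightarrow> 'b) \<Rightarrow> bool" where
  "metric_isomorphism M S M' S' \<phi> \<longleftrightarrow>
     (\<exists>U \<in> sets M. \<exists>V \<in> sets M'.
        (AE x in M. x \<in> U) \<and> (AE y in M'. y \<in> V) \<and>
        bij_betw \<phi> U V \<and>
        \<phi> \<in> restrict_space M U \<rightarrow>\<^sub>M restrict_space M' V \<and>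
        the_inv_into U \<phi> \<in> restrict_space M' V \<rightarrow>\<^sub>M restrict_space M U \<and>
        (\<forall>B \<in> sets M'. emeasure M (\<phi> -` B \<inter> U) = emeasure M' B)) \<and>
     (AE x in M. \<phi> (S x) = S' (\<phi> x))"

end

theory Submission
  imports Defs
begin

text \<open>For a parameter \<open>t\<close> put \<open>Q = T(t)\<close>, \<open>R = T(Q)\<close>, \<open>S = T(t + 1)\<close>, \<open>P = T(S)\<close>. Everything rests on two
consequences of \<open>N (i - 1) = d (d + i)\<close>.

First, the six heights are the images of each other under the maps \<open>y \<mapsto> N / (j + y)\<close>: besides
the relations \<open>A (d + i + E) = F (d + B) = D (d + F) = C (d + i + A) = N\<close>, which are built
into the definitions, there are \<open>B (d + i + D) = N\<close> and \<open>E (d + C) = N\<close>. Together with the order of the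
heights this gives that the polygon is a staircase region, that the planar map sends it into itself
(\<open>TT_region\<close>), and that the only overlaps of images of different cylinders lie on the boundary
(\<open>TT_inj_interior\<close>). So on images of interior points the chosen inverse is the true inverse
(\<open>TT_inv_TT\<close>).

Second, \<open>N / P = N / R + 1\<close> (\<open>corner_quotient\<close>). Since the digits of \<open>P\<close> and \<open>R\<close> are \<open>k + 1\<close> and \<open>k\<close>,
the orbits of \<open>t\<close> and \<open>t + 1\<close> merge after three steps. The same computation in the second coordinate
(\<open>fibre_shift\<close>) shows that for the map \<open>\<sigma>(x, y) = (x - 1, N / (N / y + 1))\<close> the third iterates of
the planar maps satisfy, in the interior of the strip \<open>D0\<close>,
\<open>TT\<^sub>\<beta>\<^sup>3 = TT\<^sub>\<alpha>\<^sup>3 \<circ> \<sigma>\<close> (\<open>branch_conjugacy\<close>), and \<open>\<sigma>\<close> maps \<open>D0\<close> onto \<open>A0\<close>.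

The inclusion of \<open>A0\<close> in the domain of \<open>\<alpha>\<close> says \<open>\<beta> \<le> P\<^sub>\<alpha>\<close>, and that of \<open>D0\<close> in the domain of \<open>\<beta>\<close> says
\<open>R\<^sub>\<beta> \<le> \<alpha> + 1\<close>. Under these inequalities each of the strips and their images is a rectangle on which
the digit is constant, except that for \<open>R\<^sub>\<beta> = \<alpha> + 1\<close> the left edge of \<open>A1\<close> has another digit; this is
why equality of the third images holds only up to a null set in that case. The domain of \<open>\<alpha>\<close> arises
from that of \<open>\<beta>\<close> by removing \<open>D0\<close>, \<open>D1\<close>, \<open>D2\<close> and adding \<open>A0\<close>, \<open>A1\<close>, \<open>A2\<close>, up to finitely many lines.

On \<open>D0\<close>, \<open>D1\<close>, \<open>D2\<close> the map of the theorem is therefore \<open>\<sigma>\<close>, carried along by the two planar maps. Each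
branch of a planar map preserves the measure with density \<open>kernel N\<close> (\<open>kernel_iso_branch\<close>), and \<open>\<sigma>\<close> is a
composition of two branches; so the map preserves this measure, the normalising constants agree, and
it is a bijection up to null sets. For the intertwining property the only interesting points are
those outside \<open>D0\<close>, \<open>D1\<close>, \<open>D2\<close> at which the digits for \<open>\<alpha>\<close> and \<open>\<beta>\<close> differ. They differ by one, the two
images are then \<open>q\<close> and \<open>\<sigma> q\<close> with \<open>q\<close> in \<open>D0\<close>, and the map sends \<open>q\<close> to \<open>\<sigma> q\<close>
(\<open>transfer_equivariant\<close>).\<close>

section \<open>Staircase polygons\<close>

lemma closed_segment_vertical:
  "closed_segment (x::real, y::real) (x, z) = {x} \<times> {min y z..max y z}"
proof -
  have "(1 - u) * x + u * x = x" for u by (simp add: algebra_simps)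
  then have "closed_segment (x, y) (x, z) = {x} \<times> closed_segment y z"
    by (auto simp: closed_segment_def)
  then show ?thesis by (auto simp: closed_segment_eq_real_ivl)
qed

lemma closed_segment_horizontal:
  "closed_segment (x::real, y::real) (z, y) = {min x z..max x z} \<times> {y}"
proof -
  have "(1 - u) * y + u * y = y" for u by (simp add: algebra_simps)
  then have "closed_segment (x, y) (z, y) = closed_segment x z \<times> {y}"
    by (auto simp: closed_segment_def)
  then show ?thesis by (auto simp: closed_segment_eq_real_ivl)
qed

text \<open>A ray that avoids \<open>K\<close> is connected and unbounded, so it forces the component of its starting point to
be unbounded.\<close>

lemma ray_in_component_imp_not_inside:
  fixes p v :: "'a::real_normed_vector"
  assumes v: "v \<noteq> 0" and ray: "\<And>t. t \<ge> 0 \<Longrightarrow> p + t *\<^sub>R v \<notin> K"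
  shows "p \<notin> inside K"
proof
  assume "p \<in> inside K"
  then have bdd: "bounded (connected_component_set (- K) p)" by (simp add: inside_def)
  let ?R = "(\<lambda>t. p + t *\<^sub>R v) ` {0..}"
  have "connected ?R"
    by (intro connected_continuous_image continuous_intros convex_connected) simp
  moreover have "p \<in> ?R" by (auto intro!: image_eqI[where x = 0])
  ultimately have "?R \<subseteq> connected_component_set (- K) p"
    using ray by (intro connected_component_maximal) auto
  then have "bounded ?R" using bdd bounded_subset by blast
  then obtain b where b: "\<And>q. q \<in> ?R \<Longrightarrow> norm q \<le> b" by (auto simp: bounded_iff)
  define t where "t = (b + norm p + 1) / norm v"
  have "0 \<le> b" using b[of p] \<open>p \<in> ?R\<close> norm_ge_zero[of p] by linarith
  then have "t \<ge> 0" by (simp add: t_def)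
  have "norm (t *\<^sub>R v) = b + norm p + 1"
    using v \<open>0 \<le> b\<close> by (simp add: t_def)
  moreover have "norm (t *\<^sub>R v) \<le> norm (p + t *\<^sub>R v) + norm p"
    using norm_triangle_ineq4[of "p + t *\<^sub>R v" p] by simp
  moreover have "norm (p + t *\<^sub>R v) \<le> b" using b \<open>t \<ge> 0\<close> by auto
  ultimately show False by linarith
qed

text \<open>\<open>G\<close> is open and closed in the complement of \<open>K\<close>, so the components of its points stay inside it and
are bounded; the rays make every other point lie outside.\<close>

lemma boundary_un_inside_eqI:
  fixes K G \<Omega>' :: "'a::real_normed_vector set"
  assumes un: "\<Omega>' = G \<union> K" and disj: "G \<inter> K = {}" and op: "open G" and cl: "closed \<Omega>'"
    and bdd: "bounded \<Omega>'"
    and rays: "\<And>p. p \<notin> \<Omega>' \<Longrightarrow> \<exists>v. v \<noteq> 0 \<and> (\<forall>t\<ge>0. p + t *\<^sub>R v \<notin> \<Omega>')"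
  shows "K \<union> inside K = \<Omega>'"
proof
  show "\<Omega>' \<subseteq> K \<union> inside K"
  proof
    fix p assume "p \<in> \<Omega>'"
    show "p \<in> K \<union> inside K"
    proof (cases "p \<in> K")
      case False
      then have "p \<in> G" using \<open>p \<in> \<Omega>'\<close> un by auto
      have "connected_component_set (- K) p \<subseteq> G"
      proof (rule ccontr)
        let ?c = "connected_component_set (- K) p"
        assume "\<not> ?c \<subseteq> G"
        then have "?c \<inter> - \<Omega>' \<noteq> {}" using un connected_component_subset[of "- K" p] by auto
        moreover have "?c \<inter> G \<noteq> {}"
          using \<open>p \<in> G\<close> False by (metis ComplI connected_component_refl_eq disjoint_iff mem_Collect_eq)
        moreover have "?c \<subseteq> G \<union> - \<Omega>'"
          using un connected_component_subset[of "- K" p] by auto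
        moreover have "open (- \<Omega>')" using cl by auto
        moreover have "G \<inter> - \<Omega>' \<inter> ?c = {}" using un by auto
        ultimately show False
          using connected_connected_component[of "- K" p] op
          unfolding connected_def by blast
      qed
      then have "bounded (connected_component_set (- K) p)"
        using bdd un by (meson bounded_subset sup_ge1)
      then show ?thesis using False by (simp add: inside_def)
    qed simp
  qed
next
  have "p \<notin> inside K" if out: "p \<notin> \<Omega>'" for p
  proof -
    obtain v where "v \<noteq> 0" "\<And>t. t \<ge> 0 \<Longrightarrow> p + t *\<^sub>R v \<notin> \<Omega>'" using rays[OF out] by auto
    then show ?thesis using un by (intro ray_in_component_imp_not_inside[of v]) auto
  qed
  then show "K \<union> inside K \<subseteq> \<Omega>'" using un by auto
qed

text \<open>A staircase polygon over \<open>[a, b]\<close>: the lower boundary rises from \<open>A\<close> to \<open>B\<close> at \<open>P\<close> and to \<open>C\<close> at \<open>Q\<close>, the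
upper one from \<open>D\<close> to \<open>E\<close> at \<open>S\<close> and to \<open>F\<close> at \<open>R\<close>. The order of \<open>P\<close> and \<open>S\<close>, and of \<open>Q\<close> and \<open>R\<close>, is left open.\<close>

locale staircase =
  fixes a b P Q R S A B C D E F :: real
  assumes lower_corners: "a < P" "P < Q" "Q < b" and upper_corners: "a < S" "S < R" "R < b"
    and corner_order: "P < R" "S < Q"
    and lower_heights: "A < B" "B < C" and upper_heights: "D < E" "E < F"
    and height_order: "B < D" "C < E"
begin

definition region :: "(real \<times> real) set" where
  "region = {(x, y). a \<le> x \<and> x \<le> b \<and> A \<le> y \<and> y \<le> F \<and>
     (P < x \<longrightarrow> B \<le> y) \<and> (Q < x \<longrightarrow> C \<le> y) \<and> (x < R \<longrightarrow> y \<le> E) \<and> (x < S \<longrightarrow> y \<le> D)}"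

definition region_interior :: "(real \<times> real) set" where
  "region_interior = {(x, y). a < x \<and> x < b \<and> A < y \<and> y < F \<and>
     (P \<le> x \<longrightarrow> B < y) \<and> (Q \<le> x \<longrightarrow> C < y) \<and> (x \<le> R \<longrightarrow> y < E) \<and> (x \<le> S \<longrightarrow> y < D)}"

lemma open_region_interior: "open region_interior"
proof -
  have "region_interior = {p. a < fst p} \<inter> {p. fst p < b} \<inter> {p. A < snd p} \<inter> {p. snd p < F} \<inter>
    ({p. fst p < P} \<union> {p. B < snd p}) \<inter> ({p. fst p < Q} \<union> {p. C < snd p}) \<inter>
    ({p. R < fst p} \<union> {p. snd p < E}) \<inter> ({p. S < fst p} \<union> {p. snd p < D})"
    by (auto simp: region_interior_def not_le)
  also have "open \<dots>"
    by (intro open_Int open_Un open_Collect_less continuous_intros)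
  finally show ?thesis .
qed

lemma closed_region: "closed region"
proof -
  have "region = {p. a \<le> fst p} \<inter> {p. fst p \<le> b} \<inter> {p. A \<le> snd p} \<inter> {p. snd p \<le> F} \<inter>
    ({p. fst p \<le> P} \<union> {p. B \<le> snd p}) \<inter> ({p. fst p \<le> Q} \<union> {p. C \<le> snd p}) \<inter>
    ({p. R \<le> fst p} \<union> {p. snd p \<le> E}) \<inter> ({p. S \<le> fst p} \<union> {p. snd p \<le> D})"
    by (auto simp: region_def not_le)
  also have "closed \<dots>"
    by (intro closed_Int closed_Un closed_Collect_le continuous_intros)
  finally show ?thesis .
qed

lemma bounded_region: "bounded region"
proof (rule bounded_subset)
  show "bounded ({a..b} \<times> {A..F})" by (intro bounded_Times) simp_all
  show "region \<subseteq> {a..b} \<times> {A..F}" by (auto simp: region_def)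
qed

text \<open>The implications that define the region are monotone in \<open>x\<close> and \<open>y\<close>, so a violated one stays violated
in one of the four axis directions.\<close>

lemma ray_off_region:
  assumes "p \<notin> region"
  shows "\<exists>v. v \<noteq> 0 \<and> (\<forall>t\<ge>0. p + t *\<^sub>R v \<notin> region)"
proof -
  obtain x y where p: "p = (x, y)" by fastforce
  consider "x < a" | "b < x" | "y < A \<or> P < x \<and> y < B \<or> Q < x \<and> y < C"
    | "F < y \<or> x < R \<and> E < y \<or> x < S \<and> D < y"
    using assms by (force simp: p region_def)
  then show ?thesis
  proof cases
    case 1
    then have "\<forall>t\<ge>0. p + t *\<^sub>R (-1, 0) \<notin> region" by (auto simp: p region_def)
    then show ?thesis by (intro exI[of _ "(-1, 0)"]) (simp add: zero_prod_def)
  next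
    case 2
    then have "\<forall>t\<ge>0. p + t *\<^sub>R (1, 0) \<notin> region" by (auto simp: p region_def)
    then show ?thesis by (intro exI[of _ "(1, 0)"]) (simp add: zero_prod_def)
  next
    case 3
    then have "\<forall>t\<ge>0. p + t *\<^sub>R (0, -1) \<notin> region" by (auto simp: p region_def)
    then show ?thesis by (intro exI[of _ "(0, -1)"]) (simp add: zero_prod_def)
  next
    case 4
    then have "\<forall>t\<ge>0. p + t *\<^sub>R (0, 1) \<notin> region" by (auto simp: p region_def)
    then show ?thesis by (intro exI[of _ "(0, 1)"]) (simp add: zero_prod_def)
  qed
qed

lemma polygon_boundary_eq:
  "polygon_boundary [(a, A), (P, A), (P, B), (Q, B), (Q, C), (b, C), (b, F), (R, F), (R, E), (S, E),
      (S, D), (a, D)] = 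
   {a..P} \<times> {A} \<union> {P} \<times> {A..B} \<union> {P..Q} \<times> {B} \<union> {Q} \<times> {B..C} \<union> {Q..b} \<times> {C} \<union> {b} \<times> {C..F} \<union> 
   {R..b} \<times> {F} \<union> {R} \<times> {E..F} \<union> {S..R} \<times> {E} \<union> {S} \<times> {D..E} \<union> {a..S} \<times> {D} \<union> {a} \<times> {A..D}"
proof -
  have *: "C < F" "A < D" using lower_heights upper_heights height_order by auto
  then show ?thesis
    using lower_corners upper_corners lower_heights upper_heights height_order *
    by (simp add: polygon_boundary_def closed_segment_vertical closed_segment_horizontal
      min_absorb1 min_absorb2 max_absorb1 max_absorb2 Un_ac lessThan_nat_numeral lessThan_Suc nth_Cons_numeral)
qed

lemma polygon_region_eq:
  "polygon_region [(a, A), (P, A), (P, B), (Q, B), (Q, C), (b, C), (b, F), (R, F), (R, E), (S, E),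
      (S, D), (a, D)] = region"
  unfolding polygon_region_def polygon_boundary_eq
proof (rule boundary_un_inside_eqI[OF _ _ open_region_interior closed_region bounded_region ray_off_region])
  let ?K = "{a..P} \<times> {A} \<union> {P} \<times> {A..B} \<union> {P..Q} \<times> {B} \<union> {Q} \<times> {B..C} \<union> {Q..b} \<times> {C} \<union> {b} \<times> {C..F} \<union> 
   {R..b} \<times> {F} \<union> {R} \<times> {E..F} \<union> {S..R} \<times> {E} \<union> {S} \<times> {D..E} \<union> {a..S} \<times> {D} \<union> {a} \<times> {A..D}"
  note ord = lower_corners upper_corners corner_order lower_heights upper_heights height_order
  show "region_interior \<inter> ?K = {}"
    using ord by (auto simp: region_interior_def)
  have "region_interior \<subseteq> region"
    unfolding region_interior_def region_def by auto
  moreover have "?K \<subseteq> region"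
    by (intro Un_least) (use ord in \<open>auto simp: region_def\<close>)
  \<comment> \<open>a point of the region that violates a strict inequality of the interior lies on the edge that
  belongs to this inequality, or on an adjacent vertical edge\<close>
  moreover have "(x, y) \<in> region_interior \<union> ?K" if "(x, y) \<in> region" for x y
  proof -
    have xy: "a \<le> x" "x \<le> b" "A \<le> y" "y \<le> F" "P < x \<Longrightarrow> B \<le> y" "Q < x \<Longrightarrow> C \<le> y"
      "x < R \<Longrightarrow> y \<le> E" "x < S \<Longrightarrow> y \<le> D"
      using that by (simp_all add: region_def)
    consider "\<not> a < x" | "\<not> x < b" | "\<not> A < y" | "\<not> y < F" | "P \<le> x" "\<not> B < y"
      | "Q \<le> x" "\<not> C < y" | "x \<le> R" "\<not> y < E" | "x \<le> S" "\<not> y < D"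
      | "(x, y) \<in> region_interior"
      unfolding region_interior_def mem_Collect_eq prod.case by blast
    then show ?thesis
    proof cases
      case 1
      with xy(1) have "x = a" by simp
      then have "(x, y) \<in> {a} \<times> {A..D}" using xy(3,8) ord \<open>x = a\<close> by simp
      then show ?thesis by (simp only: Un_iff simp_thms)
    next
      case 2
      with xy(2) have "x = b" by simp
      then have "(x, y) \<in> {b} \<times> {C..F}" using xy(4,6) ord \<open>x = b\<close> by simp
      then show ?thesis by (simp only: Un_iff simp_thms)
    next
      case 3
      with xy(3) have "y = A" by simp
      then have "(x, y) \<in> {a..P} \<times> {A}" using xy(1,5) ord \<open>y = A\<close> by force
      then show ?thesis by (simp only: Un_iff simp_thms)
    next
      case 4
      with xy(4) have "y = F" by simp
      then have "(x, y) \<in> {R..b} \<times> {F}" using xy(2,7) ord \<open>y = F\<close> by force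
      then show ?thesis by (simp only: Un_iff simp_thms)
    next
      case 5
      have "(x, y) \<in> {P} \<times> {A..B} \<or> (x, y) \<in> {P..Q} \<times> {B}"
      proof (cases "x = P")
        case True
        then show ?thesis using 5 xy(3) by simp
      next
        case False
        with 5 have "P < x" by simp
        with 5 xy(5) have "y = B" by simp
        moreover have "\<not> Q < x" using xy(6) \<open>y = B\<close> lower_heights by force
        ultimately show ?thesis using 5 xy(1,2) by simp
      qed
      then show ?thesis by (elim disjE; simp only: Un_iff simp_thms)
    next
      case 6
      have "(x, y) \<in> {Q} \<times> {B..C} \<or> (x, y) \<in> {Q..b} \<times> {C}"
      proof (cases "x = Q")
        case True
        then show ?thesis using 6 xy(5) ord by simp
      next
        case False
        with 6 have "Q < x" by simp
        with 6 xy(6) have "y = C" by simp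
        then show ?thesis using 6 xy(1,2) by simp
      qed
      then show ?thesis by (elim disjE; simp only: Un_iff simp_thms)
    next
      case 7
      have "(x, y) \<in> {R} \<times> {E..F} \<or> (x, y) \<in> {S..R} \<times> {E}"
      proof (cases "x = R")
        case True
        then show ?thesis using 7 xy(4) by simp
      next
        case False
        with 7 have "x < R" by simp
        with 7 xy(7) have "y = E" by simp
        moreover have "\<not> x < S" using xy(8) \<open>y = E\<close> upper_heights by force
        ultimately show ?thesis using 7 xy(1,2) by simp
      qed
      then show ?thesis by (elim disjE; simp only: Un_iff simp_thms)
    next
      case 8
      have "(x, y) \<in> {S} \<times> {D..E} \<or> (x, y) \<in> {a..S} \<times> {D}"
      proof (cases "x = S")
        case True
        then show ?thesis using 8 xy(7) ord by simp
      next
        case False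
        with 8 have "x < S" by simp
        with 8 xy(8) have "y = D" by simp
        then show ?thesis using 8 xy(1,2) by simp
      qed
      then show ?thesis by (elim disjE; simp only: Un_iff simp_thms)
    qed (simp only: Un_iff simp_thms)
  qed
  then have "region \<subseteq> region_interior \<union> ?K" by (rule subrelI)
  ultimately show "region = region_interior \<union> ?K" by (simp only: set_eq_subset Un_subset_iff[of region_interior] simp_thms)
qed

end

section \<open>Heights and corners\<close>

locale parameters =
  fixes N d i :: int
  assumes N_ge_2: "N \<ge> 2" and d_ge_1: "d \<ge> 1" and i_ge_2: "i \<ge> 2"
    and resonance: "real_of_int N * (real_of_int i - 1) = real_of_int d * (real_of_int d + real_of_int i)"
begin

abbreviation "rN \<equiv> real_of_int N"
abbreviation "rd \<equiv> real_of_int d"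
abbreviation "ri \<equiv> real_of_int i"
abbreviation "A \<equiv> hA N d i"
abbreviation "B \<equiv> hB N d"
abbreviation "C \<equiv> hC N d i"
abbreviation "D \<equiv> hD N d"
abbreviation "E \<equiv> hE N d i"
abbreviation "F \<equiv> hF N d"

lemma real_bounds: "rN \<ge> 2" "rd \<ge> 1" "ri \<ge> 2"
  using N_ge_2 d_ge_1 i_ge_2 by linarith+

text \<open>Needed for \<open>B > 0\<close> and because \<open>D\<close> is given with the denominator \<open>N - d\<close>.\<close>

lemma d_less_N: "rd < rN"
proof (rule ccontr)
  assume "\<not> rd < rN"
  then have "rN * (ri - 1) \<le> rd * (ri - 1)"
    using real_bounds by (intro mult_right_mono) auto
  also have "\<dots> < rd * (rd + ri)"
    using real_bounds by (intro mult_strict_left_mono) auto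
  finally show False using resonance by simp
qed

lemma E_eq: "E = A + 1" and F_eq: "F = B + 1"
  by (simp_all add: hE_def hF_def)

text \<open>The surds are the positive roots of quadratic equations. In the product form \<open>h (j + h') = N\<close> of the
next lemmas these say that the fibre map of digit \<open>j\<close> sends height \<open>h'\<close> to height \<open>h\<close>.\<close>

lemma A_pos: "A > 0" and A_times: "A * (rd + ri + E) = rN"
proof -
  define m where "m = rd + ri + 1"
  have "m > 0" using real_bounds by (simp add: m_def)
  define s where "s = sqrt (m\<^sup>2 + 4 * rN)"
  have "sqrt (m\<^sup>2) < s" unfolding s_def using real_bounds by (intro real_sqrt_less_mono) simp
  moreover have A: "A = (- m + s) / 2" by (simp add: hA_def m_def s_def)
  ultimately show "A > 0" using \<open>m > 0\<close> by simp
  have "s\<^sup>2 = m\<^sup>2 + 4 * rN" unfolding s_def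
    using real_bounds by (intro real_sqrt_pow2) simp
  moreover have s: "s = 2 * A + m" using A by simp
  ultimately have "A * (A + m) = rN" unfolding s by (simp add: power2_eq_square algebra_simps)
  then show "A * (rd + ri + E) = rN" by (simp add: m_def E_eq algebra_simps)
qed

lemma B_pos: "B > 0" and F_times: "F * (rd + B) = rN"
proof -
  define s where "s = sqrt ((rd - 1)\<^sup>2 + 4 * rN)"
  have "(rd + 1)\<^sup>2 < (rd - 1)\<^sup>2 + 4 * rN" using d_less_N by (simp add: power2_eq_square algebra_simps)
  then have "sqrt ((rd + 1)\<^sup>2) < s" unfolding s_def by (rule real_sqrt_less_mono)
  moreover have B: "B = (- (rd + 1) + s) / 2" by (simp add: hB_def s_def)
  ultimately show "B > 0" using real_bounds by simp
  have "s\<^sup>2 = (rd - 1)\<^sup>2 + 4 * rN" unfolding s_def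
    using real_bounds by (intro real_sqrt_pow2) simp
  moreover have s: "s = 2 * B + rd + 1" using B by simp
  ultimately have "(B + 1) * (rd + B) = rN" unfolding s by (simp add: power2_eq_square algebra_simps)
  then show "F * (rd + B) = rN" by (simp add: F_eq)
qed

lemma B_times_less: "B * (rd + F) = rN - rd"
  using F_times by (simp add: F_eq algebra_simps)

lemma E_times_greater: "E * (rd + ri + A) = rd + ri + rN"
  using A_times by (simp add: E_eq algebra_simps)

lemma D_times: "D * (rd + F) = rN"
proof -
  have "D = rN * B / (rN - rd)"
    by (simp add: hD_def hB_def)
  then have "D * (rd + F) = rN * (B * (rd + F)) / (rN - rd)" by simp
  also have "\<dots> = rN" using d_less_N by (simp add: B_times_less)
  finally show ?thesis .
qed

lemma C_times: "C * (rd + ri + A) = rN"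
proof -
  have *: "- real_of_int (d + i - 1) + sqrt ((real_of_int (d + i + 1))\<^sup>2 + 4 * rN) = 2 * E"
  proof -
    have "sqrt ((real_of_int (d + i + 1))\<^sup>2 + 4 * rN) = 2 * A + rd + ri + 1"
      by (simp add: hA_def field_simps)
    then show ?thesis by (simp add: E_eq)
  qed
  have "C = rN * E / (rd + ri + rN)"
    unfolding hC_def * using real_bounds by (simp add: field_simps)
  then have "C * (rd + ri + A) = rN * (E * (rd + ri + A)) / (rd + ri + rN)" by simp
  also have "\<dots> = rN" using real_bounds by (simp add: E_times_greater)
  finally show ?thesis .
qed

lemma D_pos: "D > 0"
  using D_times B_pos real_bounds F_eq
  by (intro zero_less_mult_pos2[of D "rd + F"]) auto

lemma C_pos: "C > 0"
  using C_times A_pos real_bounds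
  by (intro zero_less_mult_pos2[of C "rd + ri + A"]) auto

text \<open>This relation and \<open>E_times\<close> are where the resonance \<open>N (i - 1) = d (d + i)\<close> enters: they are equivalent
to it, given the other four relations.\<close>

lemma B_times: "B * (rd + ri + D) = rN"
proof -
  have "B * (rd + ri + D) * (rd + F) = (rd + ri) * (B * (rd + F)) + B * (D * (rd + F))"
    by (simp add: algebra_simps)
  also have "\<dots> = (rd + ri) * (rN - rd) + B * rN" by (simp add: B_times_less D_times)
  also have "\<dots> = rN * (rd + F)"
    using resonance by (simp add: F_eq algebra_simps)
  finally show ?thesis using B_pos F_eq real_bounds by simp
qed

lemma E_times: "E * (rd + C) = rN"
proof -
  have "E * (rd + C) * (rd + ri + A) = rd * (E * (rd + ri + A)) + E * (C * (rd + ri + A))"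
    by (simp add: algebra_simps)
  also have "\<dots> = rd * (rd + ri + rN) + E * rN" by (simp add: E_times_greater C_times)
  also have "\<dots> = rN * (rd + ri + A)"
    using resonance by (simp add: E_eq algebra_simps)
  finally show ?thesis using A_pos real_bounds by simp
qed

lemma heights_order: "A < B" "B < C" "C < E" "D < E" "E < F" "A < D" "B < D" "C < F"
proof -
  note pos = A_pos B_pos C_pos D_pos real_bounds E_eq F_eq
  \<comment> \<open>the fibre maps reverse the order, so one inequality between heights yields the next; the chain
  starts with \<open>B < D\<close>, \<open>C < E\<close> and \<open>C < F\<close>\<close>
  have *: "x < y" if "x * p = rN" "y * q = rN" "q < p" "q > 0" for x y p q :: real
  proof -
    have "x = rN / p" "y = rN / q" using that by (auto simp: field_simps)
    then show ?thesis using that real_bounds by (simp add: frac_less2)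
  qed
  have "B * (rd + F) < D * (rd + F)" using B_times_less D_times real_bounds by simp
  then show "B < D" using pos by (simp add: mult_less_cancel_right)
  have "C * (rd + ri + A) < E * (rd + ri + A)" using E_times_greater C_times real_bounds by simp
  then show "C < E" using pos by (simp add: mult_less_cancel_right)
  have "B < A + ri"
  proof (rule ccontr)
    assume "\<not> B < A + ri"
    then have "(A + 1 + ri) * (rd + ri + A) \<le> F * (rd + B)"
      using pos by (intro mult_mono) auto
    moreover have "(A + 1 + ri) * (rd + ri + A) = A * (rd + ri + E) + (ri * A + rd + ri + ri * (rd + ri))"
      by (simp add: E_eq algebra_simps)
    moreover have "ri * A + rd + ri + ri * (rd + ri) > 0"
      using pos by (intro add_pos_pos mult_pos_pos) auto
    ultimately have "A * (rd + ri + E) < F * (rd + B)" by linarith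
    then show False using A_times F_times by simp
  qed
  then show "C < F" using * [OF C_times F_times] pos by simp
  then show "D < E" using * [OF D_times E_times] pos by simp
  then show "A < B" using * [OF A_times B_times] pos by simp
  then show "A < D" using \<open>B < D\<close> by simp
  then show "B < C" using * [OF B_times C_times] pos by simp
  then show "E < F" using * [OF E_times F_times] pos by simp
qed

text \<open>The two corners have closed forms with the same numerator: \<open>T\<^sup>2(t) = N (i t - d) / (N - (d + i) t)\<close> and
\<open>T\<^sup>2(t + 1) = N (i t - d) / (N - d (t + 1))\<close>. The denominators differ by \<open>i t - d\<close>.\<close>

lemma corner_quotient:
  assumes t: "t > 0" and Q: "rN / t - (rd + ri) > 0" and S: "rN / (t + 1) - rd > 0"
    and R: "rN / (rN / t - (rd + ri)) - rd > 0"
  shows "rN / (rN / (rN / (t + 1) - rd) - (rd + ri)) = rN / (rN / (rN / t - (rd + ri)) - rd) + 1"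
proof -
  let ?u = "rN - (rd + ri) * t" and ?w = "rN - rd * (t + 1)" and ?c = "ri * t - rd"
  have u: "?u = t * (rN / t - (rd + ri))" and w: "?w = (t + 1) * (rN / (t + 1) - rd)"
    using t by (simp_all add: field_simps)
  then have pos: "?u > 0" "?w > 0" using t Q S by simp_all
  have *: "rN / (rN / t - (rd + ri)) - rd = rN * ?c / ?u"
  proof -
    have "rN / (rN / t - (rd + ri)) = rN * t / ?u" using t pos by (simp add: field_simps)
    also have "\<dots> - rd = (rN * t - rd * ?u) / ?u" using pos by (simp add: field_simps)
    also have "rN * t - rd * ?u = t * (rN + rd * (rd + ri)) - rN * rd" by (simp add: algebra_simps)
    also have "\<dots> = rN * ?c" unfolding resonance[symmetric] by (simp add: algebra_simps)
    finally show ?thesis .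
  qed
  have **: "rN / (rN / (t + 1) - rd) - (rd + ri) = rN * ?c / ?w"
  proof -
    have "rN / (rN / (t + 1) - rd) = rN * (t + 1) / ?w"
      using t pos by (simp add: field_simps)
    also have "\<dots> - (rd + ri) = (rN * (t + 1) - (rd + ri) * ?w) / ?w" using pos by (simp add: field_simps)
    also have "rN * (t + 1) - (rd + ri) * ?w = (t + 1) * (rN + rd * (rd + ri)) - rN * (rd + ri)"
      by (simp add: algebra_simps)
    also have "\<dots> = rN * ?c" unfolding resonance[symmetric] by (simp add: algebra_simps)
    finally show ?thesis .
  qed
  have "rN * ?c / ?u > 0" using R unfolding * .
  then have "?c > 0" using pos(1) real_bounds by (simp add: zero_less_divide_iff zero_less_mult_iff)
  have "rN / (rN * ?c / ?w) = ?w / ?c" "rN / (rN * ?c / ?u) = ?u / ?c"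
    using real_bounds by simp_all
  moreover have "?w / ?c = ?u / ?c + 1" using \<open>?c > 0\<close> by (simp add: field_simps)
  ultimately show ?thesis unfolding * ** by simp
qed

text \<open>The counterpart of \<open>corner_quotient\<close> for the second coordinate. Both sides become fractions with the
denominator \<open>N i + (d + i) v\<close>.\<close>

lemma fibre_shift:
  assumes v: "v > 0"
  shows "rN / (rd + rN / (rd + ri + rN / (rN / v + 1))) = rN / (rd + ri + rN / (rd + v)) + 1"
proof -
  let ?m = "rN * ri + rd * v + ri * v" and ?s = "rN + v"
  have pos: "?s > 0" "?m > 0" "rd + v > 0" using v real_bounds by (simp_all add: add_pos_nonneg)
  have 1: "rN / (rN / v + 1) = rN * v / ?s"
    using v pos by (simp add: field_simps)
  have 2: "rd + ri + rN * v / ?s = ((rd + ri) * ?s + rN * v) / ?s"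
    using pos by (simp add: field_simps)
  have pos3: "(rd + ri) * ?s + rN * v > 0" using pos v real_bounds by (intro add_pos_pos mult_pos_pos) auto
  have "rd * ((rd + ri) * ?s + rN * v) + rN * ?s = (rN + rd * (rd + ri)) * ?s + rN * rd * v"
    by (simp add: algebra_simps)
  also have "\<dots> = rN * ?m" unfolding resonance[symmetric] by (simp add: algebra_simps)
  finally have 3: "rd * ((rd + ri) * ?s + rN * v) + rN * ?s = rN * ?m" .
  have "a + n / (x / s) = (a * x + n * s) / x" if "x \<noteq> 0" for a n x s :: real
    using that by (simp add: add_divide_distrib)
  then have "rd + rN / (((rd + ri) * ?s + rN * v) / ?s) = rN * ?m / ((rd + ri) * ?s + rN * v)"
    unfolding 3[symmetric] using pos3 by (metis less_irrefl)
  then have l: "rN / (rd + rN / (rd + ri + rN / (rN / v + 1))) = ((rd + ri) * ?s + rN * v) / ?m"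
    unfolding 1 2 using real_bounds by simp
  have "(rd + ri) * (rd + v) + rN = ?m"
    using resonance by (simp add: algebra_simps)
  then have "rd + ri + rN / (rd + v) = ?m / (rd + v)"
    using pos by (simp add: field_simps)
  then have r: "rN / (rd + ri + rN / (rd + v)) = rN * (rd + v) / ?m" by simp
  have "(rd + ri) * ?s + rN * v = rN * (rd + v) + ?m" by (simp add: algebra_simps)
  then show ?thesis unfolding l r using pos by (simp add: add_divide_distrib)
qed

end

section \<open>The map on its planar domain\<close>

definition branch :: "int \<Rightarrow> int \<Rightarrow> real \<times> real \<Rightarrow> real \<times> real" where
  "branch N j = (\<lambda>(x, y). (of_int N / x - of_int j, of_int N / (of_int j + y)))"

lemma TT_eq_branch: "TT N \<alpha> p = branch N (digit N \<alpha> (fst p)) p"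
  by (simp add: TT_def branch_def T_def split: prod.split)

locale interval_map = parameters +
  fixes k :: int and \<alpha> :: real
  assumes k_range: "d \<le> k" "k \<le> d + i - 1"
    and alpha_in: "\<alpha> \<in> Xk N d i k"
    and R_interior: "T N \<alpha> (T N \<alpha> \<alpha>) \<in> interior (cylinder N \<alpha> k)"
    and P_interior: "T N \<alpha> (T N \<alpha> (\<alpha> + 1)) \<in> interior (cylinder N \<alpha> (k + 1))"
begin

abbreviation "Q \<equiv> T N \<alpha> \<alpha>"
abbreviation "S \<equiv> T N \<alpha> (\<alpha> + 1)"
abbreviation "R \<equiv> T N \<alpha> Q"
abbreviation "P \<equiv> T N \<alpha> S"

lemma alpha_pos: "\<alpha> > 0"
  using alpha_in by (simp add: Xk_def X_def digit_params_def)

lemma interior_cylinder: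
  assumes "x \<in> interior (cylinder N \<alpha> j)"
  shows "\<alpha> < x" "x < \<alpha> + 1" "digit N \<alpha> x = j"
proof -
  have "interior (cylinder N \<alpha> j) \<subseteq> interior {\<alpha>..\<alpha> + 1}"
    by (intro interior_mono) (auto simp: cylinder_def)
  then show "\<alpha> < x" "x < \<alpha> + 1" using assms by auto
  show "digit N \<alpha> x = j" using assms interior_subset by (auto simp: cylinder_def)
qed

lemma Q_interior: "Q \<in> interior (cylinder N \<alpha> d)"
  and S_interior: "S \<in> interior (cylinder N \<alpha> (d + i))"
  using alpha_in by (simp_all add: Xk_def X_def)

text \<open>The exceptional value of \<open>digit\<close> would give \<open>T(\<alpha>) = \<alpha> + 1\<close>, which is not an interior point of a cylinder.\<close>

lemma digit_eq: "digit N \<alpha> x = \<lfloor>rN / x - \<alpha>\<rfloor>"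
proof (cases "rN / \<alpha> - \<alpha> \<in> \<int>")
  case True
  then obtain n where n: "rN / \<alpha> - \<alpha> = of_int n" by (elim Ints_cases)
  then have "Q = \<alpha> + 1" by (simp add: T_def digit_def algebra_simps)
  then show ?thesis using interior_cylinder(2)[OF Q_interior] by simp
qed (simp add: digit_def)

lemma digit_antimono:
  assumes "\<alpha> \<le> x" "x \<le> y"
  shows "digit N \<alpha> y \<le> digit N \<alpha> x"
  unfolding digit_eq using assms alpha_pos real_bounds
  by (intro floor_mono diff_right_mono divide_left_mono mult_pos_pos) auto

lemma digit_image: "digit N \<alpha> ` {\<alpha>..\<alpha> + 1} = {d..d + i}"
  using alpha_in by (simp add: Xk_def X_def digit_params_def)

lemma digit_range:
  assumes "\<alpha> \<le> x" "x \<le> \<alpha> + 1"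
  shows "d \<le> digit N \<alpha> x" "digit N \<alpha> x \<le> d + i"
  using digit_image assms by (metis atLeastAtMost_iff imageI)+

lemma digit_ends: "digit N \<alpha> \<alpha> = d + i" "digit N \<alpha> (\<alpha> + 1) = d"
proof -
  have "d + i \<in> digit N \<alpha> ` {\<alpha>..\<alpha> + 1}" "d \<in> digit N \<alpha> ` {\<alpha>..\<alpha> + 1}"
    using i_ge_2 by (simp_all add: digit_image)
  then obtain x y where "x \<in> {\<alpha>..\<alpha> + 1}" "digit N \<alpha> x = d + i" "y \<in> {\<alpha>..\<alpha> + 1}" "digit N \<alpha> y = d"
    by (metis imageE)
  then show "digit N \<alpha> \<alpha> = d + i" "digit N \<alpha> (\<alpha> + 1) = d"
    using digit_antimono[of \<alpha> x] digit_antimono[of y "\<alpha> + 1"] digit_range[of \<alpha>] digit_range[of "\<alpha> + 1"]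
    by auto
qed

lemma digit_corners: "digit N \<alpha> Q = d" "digit N \<alpha> S = d + i" "digit N \<alpha> R = k" "digit N \<alpha> P = k + 1"
  using Q_interior S_interior R_interior P_interior by (auto dest: interior_cylinder)

lemma T_bounds: "\<alpha> \<le> T N \<alpha> x" "T N \<alpha> x < \<alpha> + 1"
  unfolding T_def digit_eq by linarith+

lemma T_antimono:
  assumes "\<alpha> \<le> x" "x \<le> y" "digit N \<alpha> x = digit N \<alpha> y"
  shows "T N \<alpha> y \<le> T N \<alpha> x"
  unfolding T_def assms(3) using assms alpha_pos real_bounds
  by (intro diff_right_mono divide_left_mono mult_pos_pos) auto

lemma T_strict_antimono:
  assumes "\<alpha> \<le> x" "x < y" "digit N \<alpha> x = digit N \<alpha> y"
  shows "T N \<alpha> y < T N \<alpha> x"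
  unfolding T_def assms(3) using assms alpha_pos real_bounds
  by (intro diff_strict_right_mono divide_strict_left_mono mult_pos_pos) auto

lemma corner_bounds:
  "\<alpha> < P" "P < \<alpha> + 1" "\<alpha> < Q" "Q < \<alpha> + 1" "\<alpha> < R" "R < \<alpha> + 1" "\<alpha> < S" "S < \<alpha> + 1"
  using interior_cylinder Q_interior S_interior R_interior P_interior by blast+

lemma corner_order: "P < Q" "S < R" "P < R" "S < Q"
  using digit_antimono[of Q P] digit_antimono[of R S] digit_antimono[of R P] digit_antimono[of Q S]
    digit_corners corner_bounds k_range i_ge_2 by force+

lemma corner_eqs:
  "Q = rN / \<alpha> - (rd + ri)" "S = rN / (\<alpha> + 1) - rd" "R = rN / Q - rd" "P = rN / S - (rd + ri)"
  using T_def[of N \<alpha> \<alpha>] T_def[of N \<alpha> "\<alpha> + 1"] T_def[of N \<alpha> Q] T_def[of N \<alpha> S] digit_ends digit_corners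
  by (simp_all only: of_int_add)

text \<open>The orbits of \<open>\<alpha>\<close> and \<open>\<alpha> + 1\<close> meet after three steps.\<close>

lemma T_P_eq_T_R: "T N \<alpha> P = T N \<alpha> R"
proof -
  have "rN / P = rN / R + 1"
    using corner_quotient[of \<alpha>] alpha_pos corner_bounds unfolding corner_eqs[symmetric] by auto
  then show ?thesis using T_def[of N \<alpha> P] T_def[of N \<alpha> R] digit_corners by simp
qed

sublocale staircase \<alpha> "\<alpha> + 1" P Q R S A B C D E F
  using corner_bounds corner_order heights_order by unfold_locales auto

lemma Omega_eq: "\<Omega> N d i \<alpha> = region"
  unfolding \<Omega>_def by (rule polygon_region_eq)

lemma region_interior_subset: "region_interior \<subseteq> region"
  unfolding region_interior_def region_def by auto

text \<open>A fibre over \<open>x\<close> of digit \<open>j\<close> goes to the fibre over \<open>T x\<close>, and a bound on the latter is one of the six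
height relations read backwards. The bound needed for \<open>j + y\<close> is in danger only if \<open>j\<close> is
extreme, or if \<open>y > E\<close> or \<open>y < B\<close>, and then \<open>x\<close> lies on a known side of a corner. As \<open>T\<close> decreases on
each cylinder, this puts \<open>T x\<close> on a known side of the next corner.\<close>

lemma TT_region:
  assumes "p \<in> region"
  shows "TT N \<alpha> p \<in> region"
proof -
  obtain x y where p: "p = (x, y)" by fastforce
  have xy: "\<alpha> \<le> x" "x \<le> \<alpha> + 1" "A \<le> y" "y \<le> F" and lo: "P < x \<Longrightarrow> B \<le> y" "Q < x \<Longrightarrow> C \<le> y"
    and hi: "x < R \<Longrightarrow> y \<le> E" "x < S \<Longrightarrow> y \<le> D"
    using assms by (auto simp: p region_def)
  define j where "j = digit N \<alpha> x"
  define z where "z = T N \<alpha> x"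
  have j: "d \<le> j" "j \<le> d + i" using digit_range xy by (auto simp: j_def)
  then have rj: "rd \<le> of_int j" "of_int j \<le> rd + ri"
    using of_int_le_iff[of d j] of_int_le_iff[of j "d + i"] by simp_all
  have z: "\<alpha> \<le> z" "z < \<alpha> + 1" using T_bounds by (auto simp: z_def)
  have pos: "of_int j + y > 0" using rj xy A_pos real_bounds by linarith
  have below: "h \<le> rN / (of_int j + y)" if "h * q = rN" "of_int j + y \<le> q" for h q
  proof -
    have "h = rN / q" using that pos by (auto simp: field_simps)
    also have "\<dots> \<le> rN / (of_int j + y)" using that pos real_bounds by (intro divide_left_mono mult_pos_pos) auto
    finally show ?thesis .
  qed
  have above: "rN / (of_int j + y) \<le> h" if "h * q = rN" "q \<le> of_int j + y" "q > 0" for h q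
  proof -
    have "h = rN / q" using that by (auto simp: field_simps)
    moreover have "\<dots> \<ge> rN / (of_int j + y)" using that pos real_bounds by (intro divide_left_mono mult_pos_pos) auto
    ultimately show ?thesis by simp
  qed
  \<comment> \<open>the position of \<open>x\<close> relative to the corners bounds its digit and its image\<close>
  have jR: "j \<le> k" if "R \<le> x" using digit_antimono[of R x] that corner_bounds digit_corners by (auto simp: j_def)
  have jP: "k + 1 \<le> j" if "x \<le> P" using digit_antimono[of x P] that xy corner_bounds digit_corners by (auto simp: j_def)
  have zS: "z \<le> P" if "j = d + i" "S \<le> x"
    using T_antimono[of S x] that corner_bounds digit_corners by (auto simp: j_def z_def)
  have zQ: "R \<le> z" if "j = d" "x \<le> Q"
    using T_antimono[of x Q] that xy digit_corners by (auto simp: j_def z_def)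
  have za: "z \<le> Q" if "j = d + i"
    using T_antimono[of \<alpha> x] that xy digit_ends by (auto simp: j_def z_def)
  have zb: "S \<le> z" if "j = d"
    using T_antimono[of x "\<alpha> + 1"] that xy digit_ends by (auto simp: j_def z_def)
  have zR: "z \<le> T N \<alpha> R" if "j = k" "R \<le> x"
    using T_antimono[of R x] that corner_bounds digit_corners by (auto simp: j_def z_def)
  have zP: "T N \<alpha> R \<le> z" if "j = k + 1" "x \<le> P"
    using T_antimono[of x P] that xy digit_corners T_P_eq_T_R by (auto simp: j_def z_def)
  have TRQ: "T N \<alpha> R \<le> Q" if "k + 1 = d + i"
    using T_antimono[of \<alpha> P] that corner_bounds digit_corners digit_ends T_P_eq_T_R by auto
  have TRS: "S \<le> T N \<alpha> R" if "k = d"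
    using T_antimono[of R "\<alpha> + 1"] that corner_bounds digit_corners digit_ends by auto
  note ord = heights_order A_pos real_bounds E_eq F_eq
  have r1: "of_int j \<le> rd + ri - 1" if "j \<noteq> d + i" using that j by linarith
  have r2: "of_int j \<ge> rd + 1" if "j \<noteq> d" using that j by linarith
  have yE: "j \<noteq> d + i" if "y > E" using jR hi that k_range by force
  have yB: "j \<noteq> d" if "y < B" using jP lo that k_range by force
  have "A \<le> rN / (of_int j + y)"
  proof (rule below[OF A_times])
    show "of_int j + y \<le> rd + ri + E"
      using r1 yE rj xy ord by (cases "y > E") auto
  qed
  moreover have "rN / (of_int j + y) \<le> F"
  proof (rule above[OF F_times])
    show "rd + B \<le> of_int j + y"
      using r2 yB rj xy ord by (cases "y < B") auto
  qed (use B_pos real_bounds in simp)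
  moreover have "B \<le> rN / (of_int j + y)" if "P < z"
  proof (rule below[OF B_times])
    have "y \<le> D" if "j = d + i"
      using zS hi \<open>P < z\<close> that by fastforce
    then show "of_int j + y \<le> rd + ri + D"
      using r1 rj xy ord by (cases "j = d + i") auto
  qed
  moreover have "C \<le> rN / (of_int j + y)" if "Q < z"
  proof (rule below[OF C_times])
    have 1: "j \<noteq> d + i" using za that by auto
    \<comment> \<open>digit \<open>d + i - 1\<close> is excluded here, as \<open>T R = T P\<close> would lie to the left of \<open>Q\<close>\<close>
    have 2: "j \<le> d + i - 2" if "y > E"
    proof -
      have "R \<le> x" using hi that by force
      then have "j \<le> k" "j \<noteq> d + i - 1" using jR zR TRQ \<open>Q < z\<close> k_range by force+
      then show ?thesis using k_range by linarith
    qed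
    show "of_int j + y \<le> rd + ri + A"
    proof (cases "y > E")
      case True
      then have "real_of_int j \<le> rd + ri - 2" using 2 by linarith
      then show ?thesis using xy ord by simp
    next
      case False
      then show ?thesis using 1 r1 ord by auto
    qed
  qed
  moreover have "rN / (of_int j + y) \<le> E" if "z < R"
  proof (rule above[OF E_times])
    have "y \<ge> C" if "j = d"
      using zQ lo \<open>z < R\<close> that by fastforce
    then show "rd + C \<le> of_int j + y"
      using r2 rj xy ord by (cases "j = d") auto
  qed (use C_pos real_bounds in simp)
  moreover have "rN / (of_int j + y) \<le> D" if "z < S"
  proof (rule above[OF D_times])
    have 1: "j \<noteq> d" using zb that by auto
    \<comment> \<open>digit \<open>d + 1\<close> is excluded here, as \<open>T P = T R\<close> would lie to the right of \<open>S\<close>\<close>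
    have 2: "j \<ge> d + 2" if "y < B"
    proof -
      have "x \<le> P" using lo that by force
      then have "j \<ge> k + 1" "j \<noteq> d + 1" using jP zP TRS \<open>z < S\<close> k_range by force+
      then show ?thesis using k_range by linarith
    qed
    show "rd + F \<le> of_int j + y"
    proof (cases "y < B")
      case True
      then have "real_of_int j \<ge> rd + 2" using 2 by linarith
      then show ?thesis using xy ord by simp
    next
      case False
      then show ?thesis using 1 r2 ord by auto
    qed
  qed (use B_pos F_eq real_bounds in simp)
  ultimately show ?thesis
    using z by (auto simp: p TT_def region_def j_def[symmetric] z_def[symmetric])
qed

text \<open>Two points with the same image and digits \<open>j < j'\<close> satisfy \<open>y = y' + (j' - j)\<close>, while all fibres lie
between \<open>A\<close> and \<open>F = B + 1\<close> and \<open>E = A + 1\<close>. So the heights are extreme, except when \<open>y > E\<close> and \<open>y' < B\<close>.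
Then \<open>x\<close> is to the right of \<open>R\<close> and \<open>x'\<close> to the left of \<open>P\<close>, so the digits are \<open>k\<close> and \<open>k + 1\<close>, and
\<open>T R = T P\<close> separates the two images.\<close>

lemma TT_overlap:
  assumes p: "(x, y) \<in> region" and q: "(x', y') \<in> region"
    and eq: "TT N \<alpha> (x, y) = TT N \<alpha> (x', y')" and less: "digit N \<alpha> x < digit N \<alpha> x'"
  shows "(x, y) \<notin> region_interior" "(x', y') \<notin> region_interior"
proof -
  have xy: "\<alpha> \<le> x" "x \<le> \<alpha> + 1" "A \<le> y" "y \<le> F" "x < R \<Longrightarrow> y \<le> E"
    using p by (auto simp: region_def)
  have xy': "\<alpha> \<le> x'" "x' \<le> \<alpha> + 1" "A \<le> y'" "y' \<le> F" "P < x' \<Longrightarrow> B \<le> y'"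
    using q by (auto simp: region_def)
  define j j' where "j = digit N \<alpha> x" and "j' = digit N \<alpha> x'"
  note ord = heights_order A_pos real_bounds E_eq F_eq
  have "j < j'" "d \<le> j" using less digit_range xy by (auto simp: j_def j'_def)
  then have rj: "real_of_int j + 1 \<le> of_int j'" "rd \<le> of_int j" "rd \<le> of_int j'" by linarith+
  then have pos: "of_int j + y > 0" "of_int j' + y' > 0" using xy xy' A_pos real_bounds by linarith+
  have T_eq: "T N \<alpha> x = T N \<alpha> x'" and "rN / (of_int j + y) = rN / (of_int j' + y')"
    using eq by (auto simp: TT_def j_def j'_def)
  then have y_eq: "of_int j + y = of_int j' + y'" using pos real_bounds by (simp add: frac_eq_eq)
  then have gap: "y' + 1 \<le> y" using rj by linarith
  have "(x, y) \<notin> region_interior \<and> (x', y') \<notin> region_interior"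
  proof (cases "x < R \<or> P < x'")
    case True
    then have "x < R \<and> y = E \<and> y' = A \<or> P < x' \<and> y = F \<and> y' = B"
      using gap xy xy' ord by fastforce
    then show ?thesis by (auto simp: region_interior_def)
  next
    case False
    then have RP: "R \<le> x" "x' \<le> P" by auto
    then have "j \<le> k" "k + 1 \<le> j'"
      using digit_antimono[of R x] digit_antimono[of x' P] xy xy' corner_bounds digit_corners
      by (auto simp: j_def j'_def)
    moreover have "j' < j + 2"
    proof (rule ccontr)
      assume "\<not> j' < j + 2"
      then have "real_of_int j + 2 \<le> of_int j'" by linarith
      then show False using y_eq xy xy' ord by simp
    qed
    ultimately have "j = k" "j' = k + 1" by auto
    then have dig: "digit N \<alpha> R = digit N \<alpha> x" "digit N \<alpha> x' = digit N \<alpha> P"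
      using digit_corners by (simp_all add: j_def j'_def)
    have "T N \<alpha> x \<le> T N \<alpha> R" "T N \<alpha> P \<le> T N \<alpha> x'"
      using T_antimono dig RP xy' corner_bounds by simp_all
    then have "\<not> T N \<alpha> x < T N \<alpha> R" "\<not> T N \<alpha> P < T N \<alpha> x'"
      using T_eq T_P_eq_T_R by simp_all
    then have "\<not> R < x" "\<not> x' < P"
      using T_strict_antimono dig xy' corner_bounds by force+
    then have "x = R" "x' = P" using RP by linarith+
    moreover have "E \<le> y" "y' \<le> B" using gap xy xy' ord by linarith+
    ultimately show ?thesis by (auto simp: region_interior_def)
  qed
  then show "(x, y) \<notin> region_interior" "(x', y') \<notin> region_interior" by auto
qed

text \<open>One of the two points may be on the boundary; this is what makes the arbitrary choice in \<open>TT_inv\<close>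
harmless.\<close>

lemma TT_inj_interior:
  assumes p: "p \<in> region_interior" and q: "q \<in> region" and eq: "TT N \<alpha> p = TT N \<alpha> q"
  shows "p = q"
proof -
  obtain x y x' y' where pq: "p = (x, y)" "q = (x', y')" by fastforce
  have "p \<in> region" using p region_interior_subset by auto
  then have "\<not> digit N \<alpha> x < digit N \<alpha> x'" "\<not> digit N \<alpha> x' < digit N \<alpha> x"
    using TT_overlap[of x y x' y'] TT_overlap[of x' y' x y] p q eq by (auto simp: pq)
  then have dig: "digit N \<alpha> x = digit N \<alpha> x'" by simp
  have "\<alpha> \<le> x" "\<alpha> \<le> x'" "A \<le> y" "A \<le> y'" "x \<le> \<alpha> + 1" 
    using \<open>p \<in> region\<close> q by (auto simp: pq region_def)
  then have pos: "x > 0" "x' > 0" "of_int (digit N \<alpha> x) + y > 0" "of_int (digit N \<alpha> x) + y' > 0"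
    using alpha_pos A_pos real_bounds digit_range(1)[of x] by linarith+
  have "rN / x = rN / x'" "rN / (of_int (digit N \<alpha> x) + y) = rN / (of_int (digit N \<alpha> x) + y')"
    using eq by (simp_all add: pq TT_def T_def dig)
  then show ?thesis using pos real_bounds by (simp add: pq frac_eq_eq)
qed

lemma TT_inv_TT:
  assumes "p \<in> region_interior"
  shows "TT_inv N d i \<alpha> (TT N \<alpha> p) = p"
proof -
  have "p \<in> region" using assms region_interior_subset by auto
  then have "TT N \<alpha> p \<in> TT N \<alpha> ` region" by simp
  then show ?thesis
    unfolding TT_inv_def Omega_eq
    using TT_inj_interior[OF assms, of "inv_into region (TT N \<alpha>) (TT N \<alpha> p)"]
    by (simp add: inv_into_into f_inv_into_f)
qed

end

section \<open>Kernel-preserving bijections\<close>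

lemma nn_integral_reciprocal:
  fixes f :: "real \<Rightarrow> ennreal"
  assumes f [measurable]: "f \<in> borel_measurable borel" and "0 < n" "0 < a" "a < b"
  shows "(\<integral>\<^sup>+u. f u * indicator {n / b..n / a} u \<partial>lborel) =
    (\<integral>\<^sup>+x. f (n / x) * ennreal (n / x\<^sup>2) * indicator {a..b} x \<partial>lborel)"
proof -
  \<comment> \<open>a reflection, because the substitution rule is for increasing functions\<close>
  have "(\<integral>\<^sup>+u. f u * indicator {n / b..n / a} u \<partial>lborel) =
      (\<integral>\<^sup>+u. f (- u) * indicator {n / b..n / a} (- u) \<partial>lborel)"
    by (subst nn_integral_real_affine[where c = "-1" and t = 0]) simp_all
  also have "\<dots> = (\<integral>\<^sup>+u. f (- u) * indicator {- n / a..- n / b} u \<partial>lborel)"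
    by (intro nn_integral_cong) (auto split: split_indicator)
  also have "\<dots> = (\<integral>\<^sup>+x. f (- (- n / x)) * ennreal (n / x\<^sup>2) * indicator {a..b} x \<partial>lborel)"
  proof (rule nn_integral_substitution_aux)
    fix x assume "x \<in> {a..b}"
    then show "((\<lambda>x. - n / x) has_real_derivative n / x\<^sup>2) (at x)"
      using assms by (auto intro!: derivative_eq_intros simp: power2_eq_square)
  next
    show "continuous_on {a..b} (\<lambda>x. n / x\<^sup>2)"
      using assms by (intro continuous_intros) auto
  qed (use assms in auto)
  finally show ?thesis by simp
qed

lemma nn_integral_reciprocal_shift:
  fixes f :: "real \<Rightarrow> ennreal" and j :: real
  assumes f [measurable]: "f \<in> borel_measurable borel" and "0 < n" "0 < a" "a < b"
  shows "(\<integral>\<^sup>+u. f u * indicator {n / b - j..n / a - j} u \<partial>lborel) =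
    (\<integral>\<^sup>+x. f (n / x - j) * ennreal (n / x\<^sup>2) * indicator {a..b} x \<partial>lborel)"
proof -
  have "(\<integral>\<^sup>+u. f u * indicator {n / b - j..n / a - j} u \<partial>lborel) =
      (\<integral>\<^sup>+u. f (u - j) * indicator {n / b..n / a} u \<partial>lborel)"
    by (subst nn_integral_real_affine[where c = 1 and t = "- j"])
      (auto intro!: nn_integral_cong split: split_indicator)
  also have "\<dots> = (\<integral>\<^sup>+x. f (n / x - j) * ennreal (n / x\<^sup>2) * indicator {a..b} x \<partial>lborel)"
    using assms by (intro nn_integral_reciprocal) measurable
  finally show ?thesis .
qed

lemma nn_integral_shift_reciprocal:
  fixes f :: "real \<Rightarrow> ennreal" and j :: real
  assumes f [measurable]: "f \<in> borel_measurable borel" and "0 < n" "0 < j + a" "a < b"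
  shows "(\<integral>\<^sup>+u. f u * indicator {n / (j + b)..n / (j + a)} u \<partial>lborel) =
    (\<integral>\<^sup>+x. f (n / (j + x)) * ennreal (n / (j + x)\<^sup>2) * indicator {a..b} x \<partial>lborel)"
proof -
  have "(\<integral>\<^sup>+u. f u * indicator {n / (j + b)..n / (j + a)} u \<partial>lborel) =
      (\<integral>\<^sup>+x. f (n / x) * ennreal (n / x\<^sup>2) * indicator {j + a..j + b} x \<partial>lborel)"
    using assms by (intro nn_integral_reciprocal) auto
  also have "\<dots> = (\<integral>\<^sup>+x. f (n / (j + x)) * ennreal (n / (j + x)\<^sup>2) * indicator {a..b} x \<partial>lborel)"
    by (subst nn_integral_real_affine[where c = 1 and t = j])
      (auto intro!: nn_integral_cong split: split_indicator)
  finally show ?thesis .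
qed

text \<open>A branch acts on the two coordinates separately, so its Jacobian comes from two one-dimensional
substitutions and Tonelli's theorem.\<close>

lemma nn_integral_branch:
  fixes f :: "real \<times> real \<Rightarrow> ennreal" and a b c e :: real
  assumes f [measurable]: "f \<in> borel_measurable borel"
    and N: "N > 0" and x: "0 < a" "a < b" and y: "0 < of_int j + c" "c < e"
  shows "(\<integral>\<^sup>+p. f p * indicator ({N / b - j..N / a - j} \<times> {N / (j + e)..N / (j + c)}) p \<partial>lborel) =
    (\<integral>\<^sup>+p. f (branch N j p) * ennreal (N / (fst p)\<^sup>2) * ennreal (N / (j + snd p)\<^sup>2) *
      indicator ({a..b} \<times> {c..e}) p \<partial>lborel)"
proof -
  let ?n = "real_of_int N" and ?j = "real_of_int j"
  let ?I = "{?n / b - ?j..?n / a - ?j}" and ?J = "{?n / (?j + e)..?n / (?j + c)}"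
  have N': "?n > 0" using N by simp
  have f' [measurable]: "f \<in> borel_measurable (borel \<Otimes>\<^sub>M borel)"
    using f by (simp add: borel_prod)
  define h where "h u = (\<integral>\<^sup>+y. f (u, ?n / (?j + y)) * ennreal (?n / (?j + y)\<^sup>2) * indicator {c..e} y \<partial>lborel)" for u
  have h [measurable]: "h \<in> borel_measurable borel"
    unfolding h_def by measurable
  have "(\<integral>\<^sup>+p. f p * indicator (?I \<times> ?J) p \<partial>lborel) =
      (\<integral>\<^sup>+u. \<integral>\<^sup>+v. f (u, v) * indicator (?I \<times> ?J) (u, v) \<partial>lborel \<partial>lborel)"
    unfolding lborel_prod[symmetric] by (subst lborel.nn_integral_fst[symmetric]) auto
  also have "\<dots> = (\<integral>\<^sup>+u. h u * indicator ?I u \<partial>lborel)"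
  proof (intro nn_integral_cong)
    fix u
    have "(\<integral>\<^sup>+v. f (u, v) * indicator (?I \<times> ?J) (u, v) \<partial>lborel) =
        (\<integral>\<^sup>+v. f (u, v) * indicator ?J v \<partial>lborel) * indicator ?I u"
      by (subst nn_integral_multc[symmetric])
        (auto intro!: nn_integral_cong split: split_indicator)
    also have "(\<integral>\<^sup>+v. f (u, v) * indicator ?J v \<partial>lborel) = h u"
      unfolding h_def using N' y by (intro nn_integral_shift_reciprocal) measurable
    finally show "(\<integral>\<^sup>+v. f (u, v) * indicator (?I \<times> ?J) (u, v) \<partial>lborel) = h u * indicator ?I u" .
  qed
  also have "\<dots> = (\<integral>\<^sup>+x. h (?n / x - ?j) * ennreal (?n / x\<^sup>2) * indicator {a..b} x \<partial>lborel)"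
    using N' x by (intro nn_integral_reciprocal_shift) measurable
  also have "\<dots> = (\<integral>\<^sup>+x. \<integral>\<^sup>+y. f (branch N j (x, y)) * ennreal (?n / x\<^sup>2) * ennreal (?n / (?j + y)\<^sup>2) *
      indicator ({a..b} \<times> {c..e}) (x, y) \<partial>lborel \<partial>lborel)"
    unfolding h_def branch_def prod.case
    by (intro nn_integral_cong, subst nn_integral_multc[symmetric], measurable, subst nn_integral_multc[symmetric], measurable)
      (auto intro!: nn_integral_cong simp: mult_ac split: split_indicator)
  also have "\<dots> = (\<integral>\<^sup>+p. f (branch N j p) * ennreal (?n / (fst p)\<^sup>2) * ennreal (?n / (?j + snd p)\<^sup>2) *
      indicator ({a..b} \<times> {c..e}) p \<partial>lborel)"
    unfolding lborel_prod[symmetric]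
    by (subst lborel.nn_integral_fst[symmetric]) (auto simp: branch_def case_prod_beta)
  finally show ?thesis .
qed

text \<open>The branch satisfies \<open>N + x' y' = N (N + x y) / (x (j + y))\<close>, which cancels the Jacobian.\<close>

lemma kernel_branch:
  assumes "N > 0" "x > 0" "of_int j + y > 0"
  shows "kernel N (branch N j (x, y)) * (N / x\<^sup>2) * (N / (j + y)\<^sup>2) = kernel N (x, y)"
proof -
  let ?n = "real_of_int N" and ?w = "real_of_int j + y"
  have "?n + (?n / x - j) * (?n / w) = ?n * (?n + x * (w - j)) / (x * w)" if "w > 0" for w
    using assms(2) that by (simp add: field_simps)
  from this[OF assms(3)]
  have "?n + (?n / x - j) * (?n / ?w) = ?n * (?n + x * y) / (x * ?w)" by simp
  then have "kernel N (branch N j (x, y)) = ?n / (?n * (?n + x * y) / (x * ?w))\<^sup>2"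
    by (simp add: kernel_def branch_def)
  also have "\<dots> * (?n / x\<^sup>2) * (?n / ?w\<^sup>2) = ?n / (?n + x * y)\<^sup>2"
    using assms by (simp add: power_divide power_mult_distrib power2_eq_square)
  finally show ?thesis by (simp add: kernel_def)
qed

definition kernel_measure :: "int \<Rightarrow> (real \<times> real) measure" where
  "kernel_measure N = density lborel (\<lambda>p. ennreal (kernel N p))"

lemma sets_kernel_measure [simp, measurable_cong]: "sets (kernel_measure N) = sets borel"
  by (simp add: kernel_measure_def)

lemma kernel_measurable [measurable]: "kernel N \<in> borel_measurable borel"
proof -
  have "(\<lambda>p :: real \<times> real. N / (N + fst p * snd p)\<^sup>2) \<in> borel_measurable borel"
    by (simp add: borel_prod[symmetric])
  then show ?thesis by (simp add: kernel_def case_prod_beta')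
qed

lemma branch_measurable [measurable]: "branch N j \<in> borel_measurable borel"
proof -
  have "(\<lambda>p :: real \<times> real. (N / fst p - j, N / (j + snd p))) \<in> borel_measurable borel"
    by (intro borel_measurable_Pair) (simp_all add: borel_prod[symmetric])
  then show ?thesis by (simp add: branch_def case_prod_beta')
qed

definition branch_inv :: "int \<Rightarrow> int \<Rightarrow> real \<times> real \<Rightarrow> real \<times> real" where
  "branch_inv N j = (\<lambda>(u, v). (of_int N / (u + of_int j), of_int N / v - of_int j))"

lemma branch_inv_measurable [measurable]: "branch_inv N j \<in> borel_measurable borel"
proof -
  have "(\<lambda>p :: real \<times> real. (N / (fst p + j), N / snd p - j)) \<in> borel_measurable borel"
    by (intro borel_measurable_Pair) (simp_all add: borel_prod[symmetric])
  then show ?thesis by (simp add: branch_inv_def case_prod_beta')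
qed

text \<open>Both maps are required to be Borel on the whole plane, although only their restrictions to \<open>S\<close> and \<open>S'\<close>
matter; this lets piecewise definitions and compositions be measurable without further care. The
inverse is carried along explicitly so that it needs no separate construction.\<close>

definition kernel_iso where
  "kernel_iso N f g S S' \<longleftrightarrow> S \<in> sets borel \<and> S' \<in> sets borel \<and>
     f \<in> borel_measurable borel \<and> g \<in> borel_measurable borel \<and>
     (\<forall>p\<in>S. f p \<in> S' \<and> g (f p) = p) \<and> (\<forall>q\<in>S'. g q \<in> S \<and> f (g q) = q) \<and>
     (\<forall>B\<in>sets borel. emeasure (kernel_measure N) (f -` B \<inter> S) = emeasure (kernel_measure N) (B \<inter> S'))"

lemma kernel_isoD:
  assumes "kernel_iso N f g S S'"
  shows "S \<in> sets borel" "S' \<in> sets borel" "f \<in> borel_measurable borel" "g \<in> borel_measurable borel"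
    and "\<And>p. p \<in> S \<Longrightarrow> f p \<in> S'" "\<And>p. p \<in> S \<Longrightarrow> g (f p) = p"
    and "\<And>q. q \<in> S' \<Longrightarrow> g q \<in> S" "\<And>q. q \<in> S' \<Longrightarrow> f (g q) = q"
    and "\<And>B. B \<in> sets borel \<Longrightarrow> emeasure (kernel_measure N) (f -` B \<inter> S) = emeasure (kernel_measure N) (B \<inter> S')"
  using assms unfolding kernel_iso_def by blast+

lemma vimage_borel [intro]: "f \<in> borel_measurable borel \<Longrightarrow> B \<in> sets borel \<Longrightarrow> f -` B \<in> sets borel"
  using measurable_sets[of f borel borel B] by simp

lemma kernel_iso_id:
  assumes "S \<in> sets borel"
  shows "kernel_iso N (\<lambda>p. p) (\<lambda>p. p) S S"
  using assms by (simp add: kernel_iso_def)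

lemma kernel_iso_inverse:
  assumes "kernel_iso N f g S S'"
  shows "kernel_iso N g f S' S"
proof -
  note f = kernel_isoD[OF assms]
  have "emeasure (kernel_measure N) (g -` B \<inter> S') = emeasure (kernel_measure N) (B \<inter> S)" if "B \<in> sets borel" for B
  proof -
    have "p \<in> f -` (g -` B) \<inter> S \<longleftrightarrow> p \<in> B \<inter> S" for p using f(6)[of p] by (cases "p \<in> S") simp_all
    then have "f -` (g -` B) \<inter> S = B \<inter> S" by blast
    moreover have "g -` B \<in> sets borel" using f(4) that by (rule vimage_borel)
    ultimately show ?thesis using f(9)[of "g -` B"] by simp
  qed
  then show ?thesis using f by (auto simp: kernel_iso_def)
qed

lemma kernel_iso_compose:
  assumes "kernel_iso N f g S S'" and "kernel_iso N f' g' S' S''"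
  shows "kernel_iso N (f' \<circ> f) (g \<circ> g') S S''"
proof -
  note f = kernel_isoD[OF assms(1)] and f' = kernel_isoD[OF assms(2)]
  have "emeasure (kernel_measure N) ((f' \<circ> f) -` B \<inter> S) = emeasure (kernel_measure N) (B \<inter> S'')"
    if "B \<in> sets borel" for B
  proof -
    have "(f' \<circ> f) -` B \<inter> S = f -` (f' -` B \<inter> S') \<inter> S" using f(5) by auto
    then have "emeasure (kernel_measure N) ((f' \<circ> f) -` B \<inter> S) = emeasure (kernel_measure N) ((f' -` B \<inter> S') \<inter> S')"
      using f(9)[of "f' -` B \<inter> S'"] that f(2) f'(3) by (simp add: sets.Int vimage_borel)
    then show ?thesis using f'(9)[OF that] by (simp add: Int_assoc)
  qed
  then show ?thesis
    using f f' by (auto simp: kernel_iso_def intro: measurable_compose)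
qed

lemma kernel_iso_restrict:
  assumes "kernel_iso N f g S S'" and "U \<subseteq> S" "U' \<subseteq> S'" "U \<in> sets borel" "U' \<in> sets borel"
    and "\<And>p. p \<in> U \<Longrightarrow> f p \<in> U'" and "\<And>q. q \<in> U' \<Longrightarrow> g q \<in> U"
  shows "kernel_iso N f g U U'"
proof -
  note f = kernel_isoD[OF assms(1)]
  have "emeasure (kernel_measure N) (f -` B \<inter> U) = emeasure (kernel_measure N) (B \<inter> U')"
    if "B \<in> sets borel" for B
  proof -
    have "f -` B \<inter> U = f -` (B \<inter> U') \<inter> S" using f(6) assms by force
    moreover have "B \<inter> U' \<inter> S' = B \<inter> U'" using assms by auto
    ultimately show ?thesis using f(9)[of "B \<inter> U'"] that assms by (simp add: sets.Int)
  qed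
  moreover have "\<forall>p\<in>U. f p \<in> U' \<and> g (f p) = p" "\<forall>q\<in>U'. g q \<in> U \<and> f (g q) = q"
    using f(6)[OF subsetD[OF assms(2)]] f(8)[OF subsetD[OF assms(3)]] assms(6,7) by simp_all
  ultimately show ?thesis using f(3,4) assms(4,5) by (simp add: kernel_iso_def)
qed

lemma kernel_iso_union:
  assumes "kernel_iso N f g S S'" and "kernel_iso N f' g' U U'" and "S \<inter> U = {}" "S' \<inter> U' = {}"
  shows "kernel_iso N (\<lambda>p. if p \<in> S then f p else f' p) (\<lambda>q. if q \<in> S' then g q else g' q) (S \<union> U) (S' \<union> U')"
proof -
  note f = kernel_isoD[OF assms(1)] and f' = kernel_isoD[OF assms(2)]
  let ?h = "\<lambda>p. if p \<in> S then f p else f' p"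
  have "emeasure (kernel_measure N) (?h -` B \<inter> (S \<union> U)) = emeasure (kernel_measure N) (B \<inter> (S' \<union> U'))"
    if B: "B \<in> sets borel" for B
  proof -
    have "p \<in> ?h -` B \<inter> (S \<union> U) \<longleftrightarrow> p \<in> (f -` B \<inter> S) \<union> (f' -` B \<inter> U)" for p
      using assms(3) by (cases "p \<in> S") auto
    then have "?h -` B \<inter> (S \<union> U) = (f -` B \<inter> S) \<union> (f' -` B \<inter> U)" by blast
    also have "emeasure (kernel_measure N) \<dots> = emeasure (kernel_measure N) (f -` B \<inter> S) + emeasure (kernel_measure N) (f' -` B \<inter> U)"
      using B f f' assms(3) by (intro plus_emeasure[symmetric]) (auto intro!: sets.Int)
    also have "\<dots> = emeasure (kernel_measure N) (B \<inter> S') + emeasure (kernel_measure N) (B \<inter> U')"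
      using f(9)[OF B] f'(9)[OF B] by simp
    also have "\<dots> = emeasure (kernel_measure N) ((B \<inter> S') \<union> (B \<inter> U'))"
      using B f f' assms(4) by (intro plus_emeasure) (auto intro!: sets.Int)
    finally show ?thesis by (simp add: Int_Un_distrib)
  qed
  moreover have "?h \<in> borel_measurable borel" "(\<lambda>q. if q \<in> S' then g q else g' q) \<in> borel_measurable borel"
    using f f' by (auto intro!: measurable_If_set)
  moreover have "(\<forall>p\<in>S \<union> U. ?h p \<in> S' \<union> U' \<and> (if ?h p \<in> S' then g (?h p) else g' (?h p)) = p)"
  proof
    fix p assume "p \<in> S \<union> U"
    then show "?h p \<in> S' \<union> U' \<and> (if ?h p \<in> S' then g (?h p) else g' (?h p)) = p"
      using f(5,6)[of p] f'(5,6)[of p] assms(3,4) by (cases "p \<in> S") auto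
  qed
  moreover have "(\<forall>q\<in>S' \<union> U'. (if q \<in> S' then g q else g' q) \<in> S \<union> U \<and> ?h (if q \<in> S' then g q else g' q) = q)"
  proof
    fix q assume "q \<in> S' \<union> U'"
    then show "(if q \<in> S' then g q else g' q) \<in> S \<union> U \<and> ?h (if q \<in> S' then g q else g' q) = q"
      using f(7,8)[of q] f'(7,8)[of q] assms(3,4) by (cases "q \<in> S'") auto
  qed
  moreover have "S \<union> U \<in> sets borel" "S' \<union> U' \<in> sets borel" using f(1,2) f'(1,2) by auto
  ultimately show ?thesis unfolding kernel_iso_def by blast
qed

lemma rectangle_borel [intro]:
  "{a<..<b} \<times> {c<..<e} \<in> sets (borel :: (real \<times> real) measure)"
  "{a..b} \<times> {c..e} \<in> sets (borel :: (real \<times> real) measure)"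
  unfolding borel_prod[symmetric] by (intro pair_measureI; simp)+

lemma reciprocal_between:
  fixes n r s u :: real
  assumes "0 < n" "0 < r" "r < s" "n / s \<le> u" "u \<le> n / r"
  shows "r \<le> n / u" "n / u \<le> s" "r < n / u \<longleftrightarrow> u < n / r" "n / u < s \<longleftrightarrow> n / s < u"
proof -
  have "n / s > 0" using assms by simp
  then have "u > 0" using assms by linarith
  then show "r \<le> n / u" "n / u \<le> s" "r < n / u \<longleftrightarrow> u < n / r" "n / u < s \<longleftrightarrow> n / s < u"
    using assms by (simp_all add: field_simps)
qed

text \<open>The closed rectangles give the exact images of the strips; the open version below is the one used for
the isomorphism, where the rectangles have to be disjoint.\<close>

lemma kernel_iso_branch_closed:
  fixes a b c e :: real
  assumes N: "N > 0" and x: "0 < a" "a < b" and y: "0 < of_int j + c" "c < e"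
  shows "kernel_iso N (branch N j) (branch_inv N j) ({a..b} \<times> {c..e})
    ({N / b - j..N / a - j} \<times> {N / (j + e)..N / (j + c)})"
proof -
  let ?n = "real_of_int N" and ?j = "real_of_int j"
  have N': "?n > 0" using N by simp
  let ?K = "{a..b} \<times> {c..e}" and ?K' = "{?n / b - ?j..?n / a - ?j} \<times> {?n / (?j + e)..?n / (?j + c)}"
  have inv: "branch_inv N j (branch N j p) = p" if "p \<in> ?K" for p
    using that N' by (simp add: branch_def branch_inv_def prod_eq_iff case_prod_beta)
  have inv': "branch N j (branch_inv N j q) = q" if "q \<in> ?K'" for q
    using that N' by (simp add: branch_def branch_inv_def prod_eq_iff case_prod_beta)
  have to: "branch N j p \<in> ?K'" if "p \<in> ?K" for p
  proof -
    have "a \<le> fst p" "fst p \<le> b" "?j + c \<le> ?j + snd p" "?j + snd p \<le> ?j + e"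
      using that by (auto simp: mem_Times_iff)
    then show ?thesis using x y N'
      by (simp add: branch_def mem_Times_iff case_prod_beta divide_left_mono)
  qed
  have from_K': "branch_inv N j q \<in> ?K" if "q \<in> ?K'" for q
  proof -
    have "?n / b \<le> fst q + ?j" "fst q + ?j \<le> ?n / a" "?n / (?j + e) \<le> snd q" "snd q \<le> ?n / (?j + c)"
      using that by (auto simp: mem_Times_iff)
    then have "a \<le> ?n / (fst q + ?j)" "?n / (fst q + ?j) \<le> b"
      "?j + c \<le> ?n / snd q" "?n / snd q \<le> ?j + e"
      using x y N' reciprocal_between(1,2)[of ?n a b "fst q + ?j"]
        reciprocal_between(1,2)[of ?n "?j + c" "?j + e" "snd q"] by simp_all
    then show ?thesis by (simp add: branch_inv_def mem_Times_iff case_prod_beta)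
  qed
  have meas: "emeasure (kernel_measure N) (branch N j -` B \<inter> ?K) = emeasure (kernel_measure N) (B \<inter> ?K')"
    if B [measurable]: "B \<in> sets borel" for B
  proof -
    have "emeasure (kernel_measure N) (B \<inter> ?K') = (\<integral>\<^sup>+p. ennreal (kernel N p) * indicator (B \<inter> ?K') p \<partial>lborel)"
      unfolding kernel_measure_def using B by (intro emeasure_density) (auto intro!: sets.Int)
    also have "\<dots> = (\<integral>\<^sup>+p. (ennreal (kernel N p) * indicator B p) * indicator ?K' p \<partial>lborel)"
      by (intro nn_integral_cong) (auto split: split_indicator)
    also have "\<dots> = (\<integral>\<^sup>+p. (ennreal (kernel N (branch N j p)) * indicator B (branch N j p)) *
        ennreal (?n / (fst p)\<^sup>2) * ennreal (?n / (?j + snd p)\<^sup>2) * indicator ?K p \<partial>lborel)"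
      using N x y by (intro nn_integral_branch) simp_all
    also have "\<dots> = (\<integral>\<^sup>+p. ennreal (kernel N p) * indicator (branch N j -` B \<inter> ?K) p \<partial>lborel)"
    proof (intro nn_integral_cong)
      fix p :: "real \<times> real"
      obtain x y where p: "p = (x, y)" by fastforce
      show "(ennreal (kernel N (branch N j p)) * indicator B (branch N j p)) *
        ennreal (?n / (fst p)\<^sup>2) * ennreal (?n / (?j + snd p)\<^sup>2) * indicator ?K p =
        ennreal (kernel N p) * indicator (branch N j -` B \<inter> ?K) p"
      proof (cases "p \<in> branch N j -` B \<inter> ?K")
        case True
        then have "x > 0" "?j + y > 0" using assms(2,4) by (auto simp: p)
        moreover have "kernel N q \<ge> 0" for q using N' by (simp add: kernel_def split: prod.split)
        ultimately show ?thesis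
          using kernel_branch[OF N, of x j y] True N' by (simp add: p ennreal_mult'[symmetric])
      qed (auto split: split_indicator)
    qed
    also have "\<dots> = emeasure (kernel_measure N) (branch N j -` B \<inter> ?K)"
      unfolding kernel_measure_def using B by (intro emeasure_density[symmetric]) (auto intro!: sets.Int)
    finally show ?thesis by simp
  qed
  show ?thesis
    unfolding kernel_iso_def using inv inv' to from_K' meas by (auto simp del: vimage_eq)
qed

lemma kernel_iso_branch:
  fixes a b c e :: real
  assumes N: "N > 0" and x: "0 < a" "a < b" and y: "0 < of_int j + c" "c < e"
  shows "kernel_iso N (branch N j) (branch_inv N j) ({a<..<b} \<times> {c<..<e})
    ({N / b - j<..<N / a - j} \<times> {N / (j + e)<..<N / (j + c)})"
proof -
  let ?n = "real_of_int N" and ?j = "real_of_int j"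
  have N': "?n > 0" using N by simp
  show ?thesis
  proof (rule kernel_iso_restrict[OF kernel_iso_branch_closed[OF assms]])
    fix p assume "p \<in> {a<..<b} \<times> {c<..<e}"
    then have "a < fst p" "fst p < b" "?j + c < ?j + snd p" "?j + snd p < ?j + e"
      by (auto simp: mem_Times_iff)
    then show "branch N j p \<in> {?n / b - ?j<..<?n / a - ?j} \<times> {?n / (?j + e)<..<?n / (?j + c)}"
      using x y N' by (simp add: branch_def mem_Times_iff case_prod_beta divide_strict_left_mono)
  next
    fix q assume "q \<in> {?n / b - ?j<..<?n / a - ?j} \<times> {?n / (?j + e)<..<?n / (?j + c)}"
    then have q: "?n / b < fst q + ?j" "fst q + ?j < ?n / a" "?n / (?j + e) < snd q" "snd q < ?n / (?j + c)"
      by (auto simp: mem_Times_iff)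
    then have "a < ?n / (fst q + ?j)" "?n / (fst q + ?j) < b"
      "?j + c < ?n / snd q" "?n / snd q < ?j + e"
      using x y N' reciprocal_between(3,4)[of ?n a b "fst q + ?j"]
        reciprocal_between(3,4)[of ?n "?j + c" "?j + e" "snd q"] by simp_all
    then show "branch_inv N j q \<in> {a<..<b} \<times> {c<..<e}"
      by (simp add: branch_inv_def mem_Times_iff case_prod_beta)
  next
    show "{a<..<b} \<times> {c<..<e} \<subseteq> {a..b} \<times> {c..e}" by (intro Sigma_mono) auto
    show "{?n / b - ?j<..<?n / a - ?j} \<times> {?n / (?j + e)<..<?n / (?j + c)} \<subseteq> {?n / b - ?j..?n / a - ?j} \<times> {?n / (?j + e)..?n / (?j + c)}"
      by (intro Sigma_mono) auto
  qed auto
qed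

section \<open>Metric isomorphisms from kernel-preserving bijections\<close>

lemma kernel_iso_image:
  assumes "kernel_iso N f g S S'"
  shows "f ` S = S'"
  using kernel_isoD(5,7,8)[OF assms] by force

lemma AE_off_countable_lines:
  fixes X Y :: "real set"
  assumes "countable X" "countable Y"
  shows "AE p in lborel. fst p \<notin> X \<and> snd p \<notin> Y"
proof -
  have X: "X \<in> sets lborel" "Y \<in> sets lborel"
    using assms by (auto intro: sets.countable)
  have "emeasure lborel (X \<times> (UNIV :: real set)) = 0" "emeasure lborel ((UNIV :: real set) \<times> Y) = 0"
    unfolding lborel_prod[symmetric] using X assms
    by (simp_all add: lborel.emeasure_pair_measure_Times emeasure_lborel_countable)
  moreover have "X \<times> (UNIV :: real set) \<in> sets lborel" "(UNIV :: real set) \<times> Y \<in> sets lborel"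
    unfolding lborel_prod[symmetric] using X by (auto intro!: pair_measureI)
  ultimately have "AE p in lborel. p \<notin> X \<times> (UNIV :: real set)" "AE p in lborel. p \<notin> (UNIV :: real set) \<times> Y"
    by (auto intro!: AE_not_in null_setsI)
  then show ?thesis by eventually_elim (auto simp: mem_Times_iff)
qed

text \<open>The preimage of a line \<open>x = c\<close> consists of the lines \<open>x = N / (c + j)\<close>, one for each digit, and
similarly for \<open>y\<close>. The formula covers \<open>x = 0\<close> as well, since \<open>N / 0 = 0\<close>.\<close>

lemma AE_TT_off_countable_lines:
  fixes G H :: "real set"
  assumes N: "N \<noteq> 0" and "countable G" "countable H"
  shows "AE p in lborel. fst (TT N \<alpha> p) \<notin> G \<and> snd (TT N \<alpha> p) \<notin> H"
proof -
  let ?xs = "\<Union>c\<in>G. \<Union>j::int. {N / (c + j)}" and ?ys = "\<Union>c\<in>H. \<Union>j::int. {N / c - j}"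
  have "AE p in lborel. fst p \<notin> ?xs \<and> snd p \<notin> ?ys"
    using assms by (intro AE_off_countable_lines countable_UN) auto
  then show ?thesis
  proof eventually_elim
    case (elim p)
    obtain x y where p: "p = (x, y)" by fastforce
    define j where "j = digit N \<alpha> x"
    have "fst (TT N \<alpha> p) \<notin> G"
    proof
      assume c: "fst (TT N \<alpha> p) \<in> G"
      have "fst p = N / (fst (TT N \<alpha> p) + j)"
        using elim N by (simp add: p TT_def T_def j_def)
      then have "fst p \<in> {N / (fst (TT N \<alpha> p) + j)}" by (simp only: singleton_iff)
      then have "fst p \<in> ?xs" using c by blast
      then show False using elim by blast
    qed
    moreover have "snd (TT N \<alpha> p) \<notin> H"
    proof
      assume c: "snd (TT N \<alpha> p) \<in> H"
      have "snd p = N / snd (TT N \<alpha> p) - j"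
        using N by (simp add: p TT_def j_def)
      then have "snd p \<in> {N / snd (TT N \<alpha> p) - j}" by (simp only: singleton_iff)
      then have "snd p \<in> ?ys" using c by blast
      then show False using elim by blast
    qed
    ultimately show ?case by simp
  qed
qed

text \<open>The shape of \<open>mu\<close>, with any Borel set in place of the polygon.\<close>

definition normalized_kernel_measure :: "int \<Rightarrow> (real \<times> real) set \<Rightarrow> (real \<times> real) measure" where
  "normalized_kernel_measure N W = density (restrict_space lborel W)
     (\<lambda>p. ennreal (1 / set_lebesgue_integral lborel W (kernel N) * kernel N p))"

lemma mu_eq_normalized: "mu N d i \<alpha> = normalized_kernel_measure N (\<Omega> N d i \<alpha>)"
  by (simp add: mu_def norm_const_def normalized_kernel_measure_def)

lemma kernel_nonneg: "N \<ge> 0 \<Longrightarrow> kernel N p \<ge> 0"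
  by (simp add: kernel_def split: prod.split)

lemma set_integral_kernel:
  assumes "N \<ge> 0" and W: "W \<in> sets borel"
  shows "set_lebesgue_integral lborel W (kernel N) = enn2real (emeasure (kernel_measure N) W)"
proof -
  have "set_lebesgue_integral lborel W (kernel N) = enn2real (\<integral>\<^sup>+p. ennreal (indicator W p *\<^sub>R kernel N p) \<partial>lborel)"
    unfolding set_lebesgue_integral_def using assms kernel_nonneg
    by (intro integral_eq_nn_integral) auto
  also have "(\<integral>\<^sup>+p. ennreal (indicator W p *\<^sub>R kernel N p) \<partial>lborel) = emeasure (kernel_measure N) W"
    unfolding kernel_measure_def using W
    by (subst emeasure_density) (auto intro!: nn_integral_cong split: split_indicator)
  finally show ?thesis .
qed

lemma sets_normalized_kernel_measure:
  assumes "W \<in> sets borel"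
  shows "B \<in> sets (normalized_kernel_measure N W) \<longleftrightarrow> B \<in> sets borel \<and> B \<subseteq> W"
  using assms by (auto simp: normalized_kernel_measure_def sets_restrict_space_iff)

lemma emeasure_normalized_kernel_measure:
  assumes "N \<ge> 0" and W: "W \<in> sets borel" and B: "B \<in> sets borel" "B \<subseteq> W"
  shows "emeasure (normalized_kernel_measure N W) B =
    ennreal (1 / set_lebesgue_integral lborel W (kernel N)) * emeasure (kernel_measure N) B"
proof -
  let ?h = "1 / set_lebesgue_integral lborel W (kernel N)"
  have h: "?h \<ge> 0" using assms by (simp add: set_integral_kernel)
  have "emeasure (normalized_kernel_measure N W) B =
      (\<integral>\<^sup>+p. ennreal (?h * kernel N p) * indicator B p \<partial>restrict_space lborel W)"
    unfolding normalized_kernel_measure_def using assms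
    by (intro emeasure_density) (auto simp: sets_restrict_space_iff intro!: measurable_restrict_space1)
  also have "\<dots> = (\<integral>\<^sup>+p. ennreal (?h * kernel N p) * indicator B p * indicator W p \<partial>lborel)"
    using W by (subst nn_integral_restrict_space) auto
  also have "\<dots> = (\<integral>\<^sup>+p. ennreal ?h * (ennreal (kernel N p) * indicator B p) \<partial>lborel)"
  proof (intro nn_integral_cong)
    fix p
    show "ennreal (?h * kernel N p) * indicator B p * indicator W p =
        ennreal ?h * (ennreal (kernel N p) * indicator B p)"
      unfolding ennreal_mult'[OF h] using B(2) by (auto simp: mult_ac split: split_indicator)
  qed
  also have "\<dots> = ennreal ?h * (\<integral>\<^sup>+p. ennreal (kernel N p) * indicator B p \<partial>lborel)"
    using B by (intro nn_integral_cmult) auto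
  also have "(\<integral>\<^sup>+p. ennreal (kernel N p) * indicator B p \<partial>lborel) = emeasure (kernel_measure N) B"
    unfolding kernel_measure_def using B by (subst emeasure_density) auto
  finally show ?thesis .
qed

lemma AE_normalized_kernel_measure:
  assumes W: "W \<in> sets borel" and "AE p in lborel. p \<in> W \<longrightarrow> \<Phi> p"
  shows "AE p in normalized_kernel_measure N W. \<Phi> p"
proof -
  have "AE p in restrict_space lborel W. \<Phi> p"
    using assms by (subst AE_restrict_space_iff) auto
  then show ?thesis
    unfolding normalized_kernel_measure_def
    by (subst AE_density) (auto intro!: measurable_restrict_space1)
qed

text \<open>The kernel measure is absolutely continuous, so Lebesgue null sets do not matter.\<close>

lemma emeasure_kernel_measure_cong_AE:
  assumes "U \<subseteq> W" "U \<in> sets borel" "W \<in> sets borel" and "AE p in lborel. p \<in> W \<longrightarrow> p \<in> U"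
  shows "emeasure (kernel_measure N) U = emeasure (kernel_measure N) W"
proof (rule emeasure_eq_AE)
  show "AE p in kernel_measure N. (p \<in> U) = (p \<in> W)"
    unfolding kernel_measure_def using assms by (subst AE_density) auto
qed (use assms in auto)

lemma measurable_restrict_normalized:
  assumes h: "h0 \<in> borel_measurable borel" "\<And>p. p \<in> S1 \<Longrightarrow> h p = h0 p" "\<And>p. p \<in> S1 \<Longrightarrow> h p \<in> S2"
    and 1: "S1 \<in> sets borel" "S1 \<subseteq> W1" "W1 \<in> sets borel"
    and 2: "S2 \<in> sets borel" "S2 \<subseteq> W2" "W2 \<in> sets borel"
  shows "h \<in> restrict_space (normalized_kernel_measure N W1) S1 \<rightarrow>\<^sub>M
    restrict_space (normalized_kernel_measure N W2) S2"
proof -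
  have sets: "sets (restrict_space (normalized_kernel_measure N W) S) = sets (restrict_space borel S)"
    if "S \<in> sets borel" "S \<subseteq> W" "W \<in> sets borel" for W S
  proof (intro set_eqI)
    fix B
    have "S \<inter> space (normalized_kernel_measure N W) \<in> sets (normalized_kernel_measure N W)"
      using that by (intro sets.Int) (auto simp: sets_normalized_kernel_measure)
    then show "B \<in> sets (restrict_space (normalized_kernel_measure N W) S) \<longleftrightarrow> B \<in> sets (restrict_space borel S)"
      using that by (subst (1 2) sets_restrict_space_iff) (auto simp: sets_normalized_kernel_measure)
  qed
  have "h0 \<in> restrict_space borel S1 \<rightarrow>\<^sub>M borel" using h(1) by (rule measurable_restrict_space1)
  moreover have "h0 \<in> space (restrict_space borel S1) \<rightarrow> S2"
    using h(2,3) by (auto simp: space_restrict_space)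
  ultimately have "h0 \<in> restrict_space borel S1 \<rightarrow>\<^sub>M restrict_space borel S2"
    by (intro measurable_restrict_space2)
  then have "h \<in> restrict_space borel S1 \<rightarrow>\<^sub>M restrict_space borel S2"
    using h(2) by (subst measurable_cong[where g = h0]) (auto simp: space_restrict_space)
  then show ?thesis
    by (subst measurable_cong_sets[OF sets[OF 1] sets[OF 2]])
qed

text \<open>A bijection that preserves the kernel measure also preserves the total mass, so the normalising
constants of the two measures are the same and need not be computed.\<close>

lemma metric_isomorphism_normalized_kernel:
  assumes N: "N \<ge> 0" and W: "W \<in> sets borel" "W' \<in> sets borel"
    and iso: "kernel_iso N f g U V" and U: "U \<subseteq> W" "AE p in lborel. p \<in> W \<longrightarrow> p \<in> U"
    and V: "V \<subseteq> W'" "AE p in lborel. p \<in> W' \<longrightarrow> p \<in> V"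
    and \<phi>: "\<And>p. p \<in> U \<Longrightarrow> \<phi> p = f p"
    and eqv: "AE p in lborel. p \<in> W \<longrightarrow> \<phi> (S p) = S' (\<phi> p)"
  shows "metric_isomorphism (normalized_kernel_measure N W) S (normalized_kernel_measure N W') S' \<phi>"
proof -
  let ?M = "normalized_kernel_measure N W" and ?M' = "normalized_kernel_measure N W'"
  note f = kernel_isoD[OF iso]
  have const: "set_lebesgue_integral lborel W (kernel N) = set_lebesgue_integral lborel W' (kernel N)"
  proof -
    have "emeasure (kernel_measure N) U = emeasure (kernel_measure N) V"
      using f(9)[of UNIV] by simp
    then show ?thesis
      using emeasure_kernel_measure_cong_AE[OF U(1) f(1) W(1) U(2)]
        emeasure_kernel_measure_cong_AE[OF V(1) f(2) W(2) V(2)]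
      by (simp add: set_integral_kernel N W)
  qed
  have sets_U: "U \<in> sets ?M" and sets_V: "V \<in> sets ?M'"
    using f(1,2) U(1) V(1) W by (simp_all add: sets_normalized_kernel_measure)
  have bij: "bij_betw \<phi> U V"
    using f(5-8) \<phi> by (intro bij_betw_byWitness[where f' = g]) auto
  have inv: "the_inv_into U \<phi> q = g q" if "q \<in> V" for q
    using that bij f(7,8) \<phi> by (intro the_inv_into_f_eq) (auto simp: bij_betw_def)
  have space: "space (restrict_space ?M U) = U" "space (restrict_space ?M' V) = V"
    using sets.sets_into_space[OF sets_U] sets.sets_into_space[OF sets_V]
    by (auto simp: space_restrict_space)
  have meas: "emeasure ?M (\<phi> -` B \<inter> U) = emeasure ?M' B" if "B \<in> sets ?M'" for B
  proof -
    have B: "B \<in> sets borel" "B \<subseteq> W'" using that W by (simp_all add: sets_normalized_kernel_measure)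
    have eq: "\<phi> -` B \<inter> U = f -` B \<inter> U" using \<phi> by auto
    have "emeasure (kernel_measure N) (f -` B \<inter> U) = emeasure (kernel_measure N) (B \<inter> V)"
      by (rule f(9)[OF B(1)])
    also have "\<dots> = emeasure (kernel_measure N) B"
      using B f(2) V(2) by (intro emeasure_kernel_measure_cong_AE) auto
    finally have "emeasure (kernel_measure N) (f -` B \<inter> U) = emeasure (kernel_measure N) B" .
    moreover have "f -` B \<inter> U \<in> sets borel" using vimage_borel[OF f(3) B(1)] f(1) by (rule sets.Int)
    moreover have "f -` B \<inter> U \<subseteq> W" using U(1) by auto
    ultimately show ?thesis
      using emeasure_normalized_kernel_measure[OF N W(1), of "f -` B \<inter> U"]
        emeasure_normalized_kernel_measure[OF N W(2) B] unfolding eq const by simp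
  qed
  have "\<phi> \<in> restrict_space ?M U \<rightarrow>\<^sub>M restrict_space ?M' V"
    using \<phi> f(5) by (intro measurable_restrict_normalized[OF f(3) _ _ f(1) U(1) W(1) f(2) V(1) W(2)]) auto
  moreover have "the_inv_into U \<phi> \<in> restrict_space ?M' V \<rightarrow>\<^sub>M restrict_space ?M U"
    using inv f(7) by (intro measurable_restrict_normalized[OF f(4) _ _ f(2) V(1) W(2) f(1) U(1) W(1)]) auto
  moreover have "AE x in ?M. x \<in> U" "AE y in ?M'. y \<in> V"
    by (intro AE_normalized_kernel_measure W U V)+
  moreover have "AE x in ?M. \<phi> (S x) = S' (\<phi> x)"
    by (intro AE_normalized_kernel_measure W eqv)
  ultimately show ?thesis
    unfolding metric_isomorphism_def using sets_U sets_V bij meas by blast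
qed

section \<open>Strips and corners for two parameters\<close>

text \<open>The last two assumptions are what the inclusions of the strips \<open>A0\<close> and \<open>D0\<close> in the domains amount to.
The corners of the larger parameter \<open>\<beta>\<close> carry the prefix \<open>b\<close>.\<close>

locale interval_map_pair = parameters N d i + a: interval_map N d i k \<alpha> + b: interval_map N d i k \<beta>
  for N d i k :: int and \<alpha> \<beta> :: real +
  assumes less: "\<alpha> < \<beta>" and beta_le: "\<beta> \<le> a.P" and R_le: "b.R \<le> \<alpha> + 1"
begin

text \<open>One step of the map reverses the order of the corners, two steps preserve it.\<close>

lemma corner_shift: "b.Q < a.Q" "b.S < a.S" "a.R < b.R" "a.P < b.P"
proof -
  have pos: "rN > 0" "\<alpha> > 0" "\<beta> > 0" "b.Q > 0" "b.S > 0"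
    using real_bounds a.alpha_pos b.alpha_pos b.corner_bounds by auto
  show Q: "b.Q < a.Q"
    using less pos by (simp add: a.corner_eqs(1) b.corner_eqs(1) divide_strict_left_mono)
  show S: "b.S < a.S"
    using less pos by (simp add: a.corner_eqs(2) b.corner_eqs(2) divide_strict_left_mono)
  show "a.R < b.R"
    unfolding a.corner_eqs(3) b.corner_eqs(3) using Q pos by (simp add: divide_strict_left_mono)
  show "a.P < b.P"
    unfolding a.corner_eqs(4) b.corner_eqs(4) using S pos by (simp add: divide_strict_left_mono)
qed

lemma S_before_Q: "a.S < b.Q"
proof (rule ccontr)
  assume "\<not> a.S < b.Q"
  then have "digit N \<beta> a.S \<le> d"
    using b.digit_antimono[of b.Q a.S] b.corner_bounds b.digit_corners by simp
  moreover have "d + i \<le> digit N \<beta> a.S"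
  proof -
    have "rN / a.S - \<beta> = a.P - \<beta> + of_int (d + i)" using a.corner_eqs(4) by simp
    then show ?thesis unfolding b.digit_eq using beta_le by (simp add: le_floor_iff)
  qed
  ultimately show False using i_ge_2 by simp
qed

lemmas corners = corner_shift S_before_Q less beta_le R_le a.corner_bounds b.corner_bounds
  a.corner_order b.corner_order a.alpha_pos b.alpha_pos

text \<open>The digit decreases with \<open>x\<close>, so it suffices to bound it at the ends of each interval. On one side
this uses a corner of \<open>\<beta>\<close> of known digit. On the other side, in turn: \<open>d\<close> is the smallest digit; \<open>\<beta> \<le> P\<^sub>\<alpha>\<close>
bounds \<open>N / S\<^sub>\<alpha> - \<beta>\<close> from below; the digit of \<open>P\<^sub>\<alpha>\<close> for \<open>\<beta>\<close> is at most that for \<open>\<alpha>\<close>.\<close>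

lemma beta_digits:
  shows "\<alpha> + 1 \<le> x \<Longrightarrow> x \<le> \<beta> + 1 \<Longrightarrow> digit N \<beta> x = d"
    and "b.S \<le> x \<Longrightarrow> x \<le> a.S \<Longrightarrow> digit N \<beta> x = d + i"
    and "a.P \<le> x \<Longrightarrow> x \<le> b.P \<Longrightarrow> digit N \<beta> x = k + 1"
proof -
  assume "\<alpha> + 1 \<le> x" "x \<le> \<beta> + 1"
  then show "digit N \<beta> x = d"
    using b.digit_antimono[of b.Q x] b.digit_range[of x] b.digit_corners corners by simp
next
  assume x: "b.S \<le> x" "x \<le> a.S"
  have "rN / a.S - \<beta> = a.P - \<beta> + of_int (d + i)" using a.corner_eqs(4) by simp
  then have "d + i \<le> digit N \<beta> a.S" unfolding b.digit_eq using beta_le by (simp add: le_floor_iff)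
  also have "\<dots> \<le> digit N \<beta> x"
    using x corners by (intro b.digit_antimono) auto
  finally show "digit N \<beta> x = d + i"
    using x b.digit_antimono[of b.S x] b.digit_corners corners by simp
next
  assume x: "a.P \<le> x" "x \<le> b.P"
  have "digit N \<beta> x \<le> digit N \<beta> a.P"
    using x corners by (intro b.digit_antimono) auto
  also have "\<dots> \<le> digit N \<alpha> a.P"
    unfolding a.digit_eq b.digit_eq using less by (intro floor_mono) simp
  finally show "digit N \<beta> x = k + 1"
    using x b.digit_antimono[of x b.P] a.digit_corners b.digit_corners corners by simp
qed

text \<open>In the second case the point \<open>Q\<^sub>\<beta>\<close> is delicate: \<open>N / Q\<^sub>\<beta> = R\<^sub>\<beta> + d\<close>, so for \<open>R\<^sub>\<beta> = \<alpha> + 1\<close> its digit for \<open>\<alpha>\<close>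
is \<open>d + 1\<close>.\<close>

lemma alpha_digits:
  shows "\<alpha> \<le> x \<Longrightarrow> x \<le> \<beta> \<Longrightarrow> digit N \<alpha> x = d + i"
    and "b.Q \<le> x \<Longrightarrow> x \<le> a.Q \<Longrightarrow> b.Q < x \<or> b.R \<noteq> \<alpha> + 1 \<Longrightarrow> digit N \<alpha> x = d"
    and "a.R \<le> x \<Longrightarrow> x \<le> b.R \<Longrightarrow> digit N \<alpha> x = k"
proof -
  assume "\<alpha> \<le> x" "x \<le> \<beta>"
  then show "digit N \<alpha> x = d + i"
    using a.digit_antimono[of x a.S] a.digit_range[of x] a.digit_corners corners by simp
next
  assume x: "b.Q \<le> x" "x \<le> a.Q" and *: "b.Q < x \<or> b.R \<noteq> \<alpha> + 1"
  have "rN / x < \<alpha> + 1 + rd"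
  proof (cases "b.Q < x")
    case True
    then have "rN / x < rN / b.Q"
      using corners real_bounds by (intro divide_strict_left_mono) auto
    then show ?thesis using R_le b.corner_eqs(3) by simp
  next
    case False
    then have "x = b.Q" using x by simp
    then show ?thesis using * False R_le b.corner_eqs(3) by simp
  qed
  then have "digit N \<alpha> x \<le> d" unfolding a.digit_eq by (simp add: floor_le_iff)
  then show "digit N \<alpha> x = d"
    using x a.digit_antimono[of x a.Q] a.digit_corners corners by simp
next
  assume x: "a.R \<le> x" "x \<le> b.R"
  have "digit N \<beta> b.R \<le> digit N \<alpha> b.R"
    unfolding a.digit_eq b.digit_eq using less by (intro floor_mono) simp
  also have "\<dots> \<le> digit N \<alpha> x"
    using x corners by (intro a.digit_antimono) auto
  finally show "digit N \<alpha> x = k"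
    using x a.digit_antimono[of a.R x] a.digit_corners b.digit_corners corners by simp
qed

definition "rectA0 = {\<alpha><..<\<beta>} \<times> {A<..<D}"
definition "rectA1 = {b.Q<..<a.Q} \<times> {B<..<C}"
definition "rectA2 = {a.R<..<b.R} \<times> {E<..<F}"
definition "rectD0 = {\<alpha> + 1<..<\<beta> + 1} \<times> {C<..<F}"
definition "rectD1 = {b.S<..<a.S} \<times> {D<..<E}"
definition "rectD2 = {a.P<..<b.P} \<times> {A<..<B}"

lemmas rect_defs = rectA0_def rectA1_def rectA2_def rectD0_def rectD1_def rectD2_def

lemma height_quotients:
  "rN / (rd + ri + E) = A" "rN / (rd + B) = F" "rN / (rd + F) = D" "rN / (rd + ri + A) = C"
  "rN / (rd + ri + D) = B" "rN / (rd + C) = E"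
proof -
  have "rN / p = h" if "h * p = rN" for h p
  proof -
    have "p \<noteq> 0" using that real_bounds by auto
    then show ?thesis using that by (simp add: divide_eq_eq)
  qed
  then show "rN / (rd + ri + E) = A" "rN / (rd + B) = F" "rN / (rd + F) = D" "rN / (rd + ri + A) = C"
    "rN / (rd + ri + D) = B" "rN / (rd + C) = E"
    using A_times B_times C_times D_times E_times F_times by blast+
qed

lemmas heights = heights_order A_pos B_pos C_pos D_pos E_eq F_eq real_bounds

lemma N_pos: "N > 0" using N_ge_2 by simp

lemma image_D0: "branch N d ` ({\<alpha> + 1..\<beta> + 1} \<times> {C..F}) = {b.S..a.S} \<times> {D..E}"
proof -
  have "0 < \<alpha> + 1" "\<alpha> + 1 < \<beta> + 1" "0 < rd + C" "C < F" using corners heights by auto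
  from kernel_iso_image[OF kernel_iso_branch_closed[OF N_pos this]] show ?thesis
    unfolding height_quotients a.corner_eqs(2)[symmetric] b.corner_eqs(2)[symmetric] .
qed

lemma image_D1: "branch N (d + i) ` ({b.S..a.S} \<times> {D..E}) = {a.P..b.P} \<times> {A..B}"
proof -
  have "0 < b.S" "b.S < a.S" "0 < of_int (d + i) + D" "D < E" using corners heights by auto
  from kernel_iso_image[OF kernel_iso_branch_closed[OF N_pos this]] show ?thesis
    unfolding of_int_add height_quotients a.corner_eqs(4)[symmetric] b.corner_eqs(4)[symmetric] .
qed

lemma image_A0: "branch N (d + i) ` ({\<alpha>..\<beta>} \<times> {A..D}) = {b.Q..a.Q} \<times> {B..C}"
proof -
  have "0 < \<alpha>" "\<alpha> < \<beta>" "0 < of_int (d + i) + A" "A < D" using corners heights by auto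
  from kernel_iso_image[OF kernel_iso_branch_closed[OF N_pos this]] show ?thesis
    unfolding of_int_add height_quotients a.corner_eqs(1)[symmetric] b.corner_eqs(1)[symmetric] .
qed

lemma image_A1: "branch N d ` ({b.Q..a.Q} \<times> {B..C}) = {a.R..b.R} \<times> {E..F}"
proof -
  have "0 < b.Q" "b.Q < a.Q" "0 < rd + B" "B < C" using corners heights by auto
  from kernel_iso_image[OF kernel_iso_branch_closed[OF N_pos this]] show ?thesis
    unfolding height_quotients a.corner_eqs(3)[symmetric] b.corner_eqs(3)[symmetric] .
qed

text \<open>The relation \<open>N / P = N / R + 1\<close> matches the first coordinates, and \<open>k + E = (k + 1) + A\<close> and
\<open>k + F = (k + 1) + B\<close> match the second ones.\<close>

lemma image_A2_eq_image_D2: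
  "branch N k ` ({a.R..b.R} \<times> {E..F}) = branch N (k + 1) ` ({a.P..b.P} \<times> {A..B})"
proof -
  have k: "of_int k \<ge> rd" using a.k_range by simp
  have A: "0 < a.R" "a.R < b.R" "0 < of_int k + E" "E < F" using k corners heights by auto
  have D: "0 < a.P" "a.P < b.P" "0 < of_int (k + 1) + A" "A < B" using k corners heights by auto
  have "rN / a.P = rN / a.R + 1" "rN / b.P = rN / b.R + 1"
    using a.T_P_eq_T_R b.T_P_eq_T_R T_def[of N \<alpha> a.P] T_def[of N \<alpha> a.R] T_def[of N \<beta> b.P] T_def[of N \<beta> b.R]
      a.digit_corners b.digit_corners by simp_all
  then show ?thesis
    using kernel_iso_image[OF kernel_iso_branch_closed[OF N_pos A]]
      kernel_iso_image[OF kernel_iso_branch_closed[OF N_pos D]]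
    by (simp add: E_eq F_eq add_ac)
qed

lemma iso_D0: "kernel_iso N (branch N d) (branch_inv N d) rectD0 rectD1"
proof -
  have "0 < \<alpha> + 1" "\<alpha> + 1 < \<beta> + 1" "0 < rd + C" "C < F" using corners heights by auto
  from kernel_iso_branch[OF N_pos this] show ?thesis
    unfolding height_quotients a.corner_eqs(2)[symmetric] b.corner_eqs(2)[symmetric] rect_defs .
qed

lemma iso_D1: "kernel_iso N (branch N (d + i)) (branch_inv N (d + i)) rectD1 rectD2"
proof -
  have "0 < b.S" "b.S < a.S" "0 < of_int (d + i) + D" "D < E" using corners heights by auto
  from kernel_iso_branch[OF N_pos this] show ?thesis
    unfolding of_int_add height_quotients a.corner_eqs(4)[symmetric] b.corner_eqs(4)[symmetric] rect_defs .
qed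

lemma iso_A0: "kernel_iso N (branch N (d + i)) (branch_inv N (d + i)) rectA0 rectA1"
proof -
  have "0 < \<alpha>" "\<alpha> < \<beta>" "0 < of_int (d + i) + A" "A < D" using corners heights by auto
  from kernel_iso_branch[OF N_pos this] show ?thesis
    unfolding of_int_add height_quotients a.corner_eqs(1)[symmetric] b.corner_eqs(1)[symmetric] rect_defs .
qed

lemma iso_A1: "kernel_iso N (branch N d) (branch_inv N d) rectA1 rectA2"
proof -
  have "0 < b.Q" "b.Q < a.Q" "0 < rd + B" "B < C" using corners heights by auto
  from kernel_iso_branch[OF N_pos this] show ?thesis
    unfolding height_quotients a.corner_eqs(3)[symmetric] b.corner_eqs(3)[symmetric] rect_defs .
qed

text \<open>If two branches with digits \<open>j\<close> and \<open>j + 1\<close> are applied to the same point, the results are \<open>q\<close> and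
\<open>shift q\<close>. The value \<open>j = 0\<close> is used as a representative, so that preservation of the kernel measure
is inherited from the branches.\<close>

definition shift :: "real \<times> real \<Rightarrow> real \<times> real" where
  "shift = branch N 1 \<circ> branch N 0"
definition unshift :: "real \<times> real \<Rightarrow> real \<times> real" where
  "unshift = branch_inv N 0 \<circ> branch_inv N 1"

lemma shift_apply: "shift (u, v) = (u - 1, rN / (rN / v + 1))"
  using real_bounds by (simp add: shift_def branch_def add_ac)

lemma iso_shift: "kernel_iso N shift unshift rectD0 rectA0"
proof -
  have 1: "0 < \<alpha> + 1" "\<alpha> + 1 < \<beta> + 1" "0 < of_int 0 + C" "C < F" using corners heights by auto
  have 2: "0 < rN / (\<beta> + 1)" "rN / (\<beta> + 1) < rN / (\<alpha> + 1)" "0 < of_int 1 + rN / F" "rN / F < rN / C"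
    using corners heights by (auto intro!: divide_strict_left_mono add_pos_pos)
  have "rN / F = rd + B" "rN / C = rd + ri + A"
    using F_times C_times heights by (simp_all add: field_simps)
  then have 3: "rN / (1 + rN / F) = D" "rN / (1 + rN / C) = A"
    using height_quotients by (simp_all add: E_eq F_eq add_ac)
  have "kernel_iso N (branch N 0) (branch_inv N 0) rectD0
      ({rN / (\<beta> + 1)<..<rN / (\<alpha> + 1)} \<times> {rN / F<..<rN / C})"
    using kernel_iso_branch[OF N_pos 1] by (simp add: rect_defs)
  moreover have "kernel_iso N (branch N 1) (branch_inv N 1)
      ({rN / (\<beta> + 1)<..<rN / (\<alpha> + 1)} \<times> {rN / F<..<rN / C}) rectA0"
    using kernel_iso_branch[OF N_pos 2] 3 real_bounds by (simp add: rect_defs)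
  ultimately show ?thesis unfolding shift_def unshift_def by (rule kernel_iso_compose)
qed

lemma rect_interior:
  "rectA0 \<subseteq> a.region_interior" "rectA1 \<subseteq> a.region_interior" "rectA2 \<subseteq> a.region_interior"
  "rectD0 \<subseteq> b.region_interior" "rectD1 \<subseteq> b.region_interior" "rectD2 \<subseteq> b.region_interior"
proof -
  have *: "X \<subseteq> Y" if "\<And>x y. (x, y) \<in> X \<Longrightarrow> (x, y) \<in> Y" for X Y :: "(real \<times> real) set"
    using that by auto
  note [simp] = rect_defs a.region_interior_def b.region_interior_def
  show "rectA0 \<subseteq> a.region_interior"
    by (rule *, simp, intro conjI impI; use corners heights_order in linarith)
  show "rectA1 \<subseteq> a.region_interior"
    by (rule *, simp, intro conjI impI; use corners heights_order in linarith)
  show "rectA2 \<subseteq> a.region_interior"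
    by (rule *, simp, intro conjI impI; use corners heights_order in linarith)
  show "rectD0 \<subseteq> b.region_interior"
    by (rule *, simp, intro conjI impI; use corners heights_order in linarith)
  show "rectD1 \<subseteq> b.region_interior"
    by (rule *, simp, intro conjI impI; use corners heights_order in linarith)
  show "rectD2 \<subseteq> b.region_interior"
    by (rule *, simp, intro conjI impI; use corners heights_order in linarith)
qed

section \<open>Decomposition of the two domains\<close>

text \<open>The strips of the theorem and their images, up to an edge of \<open>boxA2\<close> in the case \<open>R\<^sub>\<beta> = \<alpha> + 1\<close>. The boxes share
edges with the rest of the domain, which is why the isomorphism is built on the open rectangles.\<close>

definition "boxA0 = {\<alpha>..\<beta>} \<times> {A..D}"
definition "boxA1 = {b.Q..a.Q} \<times> {B..C}"
definition "boxA2 = {a.R..b.R} \<times> {E..F}"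
definition "boxD0 = {\<alpha> + 1..\<beta> + 1} \<times> {C..F}"
definition "boxD1 = {b.S..a.S} \<times> {D..E}"
definition "boxD2 = {a.P..b.P} \<times> {A..B}"

lemmas box_defs = boxA0_def boxA1_def boxA2_def boxD0_def boxD1_def boxD2_def

lemma rect_box:
  "rectA0 \<subseteq> boxA0" "rectA1 \<subseteq> boxA1" "rectA2 \<subseteq> boxA2"
  "rectD0 \<subseteq> boxD0" "rectD1 \<subseteq> boxD1" "rectD2 \<subseteq> boxD2"
  unfolding rect_defs box_defs by (intro Sigma_mono; auto)+

text \<open>The lines that contain all edges of both domains and of all boxes. Off these lines, weak and strict
inequalities agree.\<close>

definition grid_x :: "real set" where
  "grid_x = {\<alpha>, \<alpha> + 1, \<beta>, \<beta> + 1, a.P, a.Q, a.R, a.S, b.P, b.Q, b.R, b.S}"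
definition grid_y :: "real set" where
  "grid_y = {A, B, C, D, E, F}"
definition off_grid :: "real \<times> real \<Rightarrow> bool" where
  "off_grid p \<longleftrightarrow> fst p \<notin> grid_x \<and> snd p \<notin> grid_y"

lemma box_off_grid:
  assumes "off_grid p"
  shows "p \<in> boxA0 \<Longrightarrow> p \<in> rectA0" "p \<in> boxA1 \<Longrightarrow> p \<in> rectA1" "p \<in> boxA2 \<Longrightarrow> p \<in> rectA2"
    "p \<in> boxD0 \<Longrightarrow> p \<in> rectD0" "p \<in> boxD1 \<Longrightarrow> p \<in> rectD1" "p \<in> boxD2 \<Longrightarrow> p \<in> rectD2"
proof -
  have *: "p \<in> {r<..<s} \<times> {r'<..<s'}"
    if "p \<in> {r..s} \<times> {r'..s'}" "r \<in> grid_x" "s \<in> grid_x" "r' \<in> grid_y" "s' \<in> grid_y" for r s r' s'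
    using that assms by (auto simp: off_grid_def mem_Times_iff less_le)
  show "p \<in> boxA0 \<Longrightarrow> p \<in> rectA0" "p \<in> boxA1 \<Longrightarrow> p \<in> rectA1" "p \<in> boxA2 \<Longrightarrow> p \<in> rectA2"
    "p \<in> boxD0 \<Longrightarrow> p \<in> rectD0" "p \<in> boxD1 \<Longrightarrow> p \<in> rectD1" "p \<in> boxD2 \<Longrightarrow> p \<in> rectD2"
    unfolding rect_defs box_defs by (erule *; simp add: grid_x_def grid_y_def)+
qed

text \<open>The part of the domain on which the isomorphism is the identity.\<close>

definition common :: "(real \<times> real) set" where
  "common = {p \<in> b.region. off_grid p} - (boxD0 \<union> boxD1 \<union> boxD2)"

lemma common_subset_a: "common \<subseteq> a.region"
proof
  fix p assume p: "p \<in> common"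
  obtain x y where xy: "p = (x, y)" by fastforce
  have r: "\<beta> \<le> x" "x \<le> \<beta> + 1" "A \<le> y" "y \<le> F" "b.P < x \<Longrightarrow> B \<le> y" "b.Q < x \<Longrightarrow> C \<le> y"
    "x < b.R \<Longrightarrow> y \<le> E" "x < b.S \<Longrightarrow> y \<le> D"
    using p by (auto simp: common_def xy b.region_def)
  have n: "\<not> (\<alpha> + 1 \<le> x \<and> x \<le> \<beta> + 1 \<and> C \<le> y \<and> y \<le> F)"
    "\<not> (b.S \<le> x \<and> x \<le> a.S \<and> D \<le> y \<and> y \<le> E)" "\<not> (a.P \<le> x \<and> x \<le> b.P \<and> A \<le> y \<and> y \<le> B)"
    using p by (auto simp: common_def xy box_defs)
  have "x \<le> \<alpha> + 1"
  proof (rule ccontr)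
    assume "\<not> x \<le> \<alpha> + 1"
    then have "b.Q < x" using corners by linarith
    then show False using r n(1) \<open>\<not> x \<le> \<alpha> + 1\<close> by auto
  qed
  moreover have "B \<le> y" if "a.P < x"
    using r(3,5) n(3) that by (cases "b.P < x") auto
  moreover have "C \<le> y" if "a.Q < x" using r(6) that corner_shift by force
  moreover have "y \<le> E" if "x < a.R" using r(7) that corner_shift by force
  moreover have "y \<le> D" if "x < a.S"
  proof -
    have "x < b.R" using that corners by linarith
    then show ?thesis using r(7,8) n(2) that by (cases "x < b.S") auto
  qed
  ultimately show "p \<in> a.region" using r less by (simp add: xy a.region_def)
qed

lemma region_a_minus_boxes:
  assumes p: "p \<in> a.region" and n: "p \<notin> boxA0" "p \<notin> boxA1" "p \<notin> boxA2"
  shows "p \<in> b.region"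
proof -
  obtain x y where xy: "p = (x, y)" by fastforce
  have r: "\<alpha> \<le> x" "x \<le> \<alpha> + 1" "A \<le> y" "y \<le> F" "a.P < x \<Longrightarrow> B \<le> y" "a.Q < x \<Longrightarrow> C \<le> y"
    "x < a.R \<Longrightarrow> y \<le> E" "x < a.S \<Longrightarrow> y \<le> D"
    using p by (auto simp: xy a.region_def)
  have n: "\<not> (\<alpha> \<le> x \<and> x \<le> \<beta> \<and> A \<le> y \<and> y \<le> D)"
    "\<not> (b.Q \<le> x \<and> x \<le> a.Q \<and> B \<le> y \<and> y \<le> C)" "\<not> (a.R \<le> x \<and> x \<le> b.R \<and> E \<le> y \<and> y \<le> F)"
    using n by (auto simp: xy box_defs)
  have "\<beta> \<le> x"
  proof (rule ccontr)
    assume "\<not> \<beta> \<le> x"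
    then have "x < a.S" using corners by linarith
    then show False using r n(1) \<open>\<not> \<beta> \<le> x\<close> by auto
  qed
  moreover have "B \<le> y" if "b.P < x" using r(5) that corner_shift by force
  moreover have "C \<le> y" if "b.Q < x"
  proof -
    have "a.P < x" using that corners by linarith
    then show ?thesis using r(5,6) n(2) that by (cases "a.Q < x") auto
  qed
  moreover have "y \<le> E" if "x < b.R"
    using r(4,7) n(3) that by (cases "x < a.R") auto
  moreover have "y \<le> D" if "x < b.S" using r(8) that corner_shift by force
  ultimately show "p \<in> b.region" using r less by (simp add: xy b.region_def)
qed

lemma rectA_outside_b: "p \<in> rectA0 \<union> rectA1 \<union> rectA2 \<Longrightarrow> p \<notin> b.region"
  by (auto simp: rect_defs b.region_def)

lemma rectD_outside_a: "p \<in> rectD0 \<union> rectD1 \<union> rectD2 \<Longrightarrow> p \<notin> a.region"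
  by (auto simp: rect_defs a.region_def)

text \<open>With \<open>cover_a\<close>: up to the grid, the domain of \<open>\<alpha>\<close> is that of \<open>\<beta>\<close> with the \<open>D\<close>-rectangles exchanged for
the \<open>A\<close>-rectangles.\<close>

lemma cover_b:
  assumes "p \<in> b.region" "off_grid p"
  shows "p \<in> rectD0 \<union> (rectD1 \<union> (rectD2 \<union> common))"
  using assms box_off_grid[OF assms(2)] unfolding common_def by blast

lemma cover_a:
  assumes "p \<in> a.region" "off_grid p"
  shows "p \<in> rectA0 \<union> (rectA1 \<union> (rectA2 \<union> common))"
proof (cases "p \<in> boxA0 \<union> boxA1 \<union> boxA2")
  case True
  then show ?thesis using box_off_grid[OF assms(2)] by blast
next
  case False
  then have "p \<in> b.region" using region_a_minus_boxes assms by auto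
  moreover have "p \<notin> boxD0" "p \<notin> boxD1" "p \<notin> boxD2"
    using assms box_off_grid(4-6) rectD_outside_a by blast+
  ultimately show ?thesis using assms by (auto simp: common_def)
qed

lemma rect_disjoint:
  "rectD0 \<inter> (rectD1 \<union> (rectD2 \<union> common)) = {}" "rectD1 \<inter> (rectD2 \<union> common) = {}" "rectD2 \<inter> common = {}"
  "rectA0 \<inter> (rectA1 \<union> (rectA2 \<union> common)) = {}" "rectA1 \<inter> (rectA2 \<union> common) = {}" "rectA2 \<inter> common = {}"
proof -
  have common: "rectD0 \<inter> common = {}" "rectD1 \<inter> common = {}" "rectD2 \<inter> common = {}"
    using rect_box by (auto simp: common_def)
  have common': "rectA0 \<inter> common = {}" "rectA1 \<inter> common = {}" "rectA2 \<inter> common = {}"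
    using rectA_outside_b by (auto simp: common_def)
  have *: "{r<..<s} \<times> X \<inter> {r'<..<s'} \<times> Y = {}" if "s \<le> r' \<or> s' \<le> r" for r s r' s' :: real and X Y :: "real set"
    using that by auto
  have **: "X \<times> {r<..<s} \<inter> Y \<times> {r'<..<s'} = {}" if "s \<le> r' \<or> s' \<le> r" for r s r' s' :: real and X Y :: "real set"
    using that by auto
  have x: "a.S \<le> \<alpha> + 1" "b.P \<le> \<alpha> + 1" "\<beta> \<le> b.Q" "\<beta> \<le> a.R"
    using corners by linarith+
  have D: "rectD0 \<inter> rectD1 = {}" "rectD0 \<inter> rectD2 = {}" "rectD1 \<inter> rectD2 = {}"
    using *[OF disjI2, OF x(1)] *[OF disjI2, OF x(2)] **[OF disjI2, of B D] heights_order(7)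
    by (simp_all add: rect_defs)
  have A: "rectA0 \<inter> rectA1 = {}" "rectA0 \<inter> rectA2 = {}" "rectA1 \<inter> rectA2 = {}"
    using *[OF disjI1, OF x(3)] *[OF disjI1, OF x(4)] **[OF disjI1, of C E] heights_order(3)
    by (simp_all add: rect_defs)
  show "rectD0 \<inter> (rectD1 \<union> (rectD2 \<union> common)) = {}" "rectD1 \<inter> (rectD2 \<union> common) = {}" "rectD2 \<inter> common = {}"
  "rectA0 \<inter> (rectA1 \<union> (rectA2 \<union> common)) = {}" "rectA1 \<inter> (rectA2 \<union> common) = {}" "rectA2 \<inter> common = {}"
    by (simp_all only: Int_Un_distrib common common' D A Un_empty simp_thms)
qed

lemma TT_box_D:
  "p \<in> boxD0 \<Longrightarrow> TT N \<beta> p = branch N d p"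
  "p \<in> boxD1 \<Longrightarrow> TT N \<beta> p = branch N (d + i) p"
  "p \<in> boxD2 \<Longrightarrow> TT N \<beta> p = branch N (k + 1) p"
  unfolding TT_eq_branch using beta_digits by (auto simp: box_defs)

lemma TT_box_A:
  "p \<in> boxA0 \<Longrightarrow> TT N \<alpha> p = branch N (d + i) p"
  "p \<in> boxA1 \<Longrightarrow> b.Q < fst p \<or> b.R \<noteq> \<alpha> + 1 \<Longrightarrow> TT N \<alpha> p = branch N d p"
  "p \<in> boxA2 \<Longrightarrow> TT N \<alpha> p = branch N k p"
  unfolding TT_eq_branch using alpha_digits by (auto simp: box_defs)

lemma TT_image_box_D: "TT N \<beta> ` boxD0 = boxD1" "TT N \<beta> ` boxD1 = boxD2"
proof -
  have "TT N \<beta> ` boxD0 = branch N d ` boxD0" "TT N \<beta> ` boxD1 = branch N (d + i) ` boxD1"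
    using TT_box_D by (auto intro!: image_cong)
  then show "TT N \<beta> ` boxD0 = boxD1" "TT N \<beta> ` boxD1 = boxD2"
    using image_D0 image_D1 by (simp_all add: box_defs)
qed

lemma TT_image_box_A0: "TT N \<alpha> ` boxA0 = boxA1"
proof -
  have "TT N \<alpha> ` boxA0 = branch N (d + i) ` boxA0"
    using TT_box_A by (auto intro!: image_cong)
  then show ?thesis using image_A0 by (simp add: box_defs)
qed

lemma TT_image_box_A1:
  assumes "b.R \<noteq> \<alpha> + 1"
  shows "TT N \<alpha> ` boxA1 = boxA2"
proof -
  have "TT N \<alpha> ` boxA1 = branch N d ` boxA1"
    using TT_box_A(2) assms by (auto intro!: image_cong)
  then show ?thesis using image_A1 by (simp add: box_defs)
qed

lemma TT_image_box_2: "TT N \<alpha> ` boxA2 = TT N \<beta> ` boxD2"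
proof -
  have "TT N \<alpha> ` boxA2 = branch N k ` boxA2" "TT N \<beta> ` boxD2 = branch N (k + 1) ` boxD2"
    using TT_box_A(3) TT_box_D(3) by (auto intro!: image_cong)
  then show ?thesis using image_A2_eq_image_D2 by (simp add: box_defs)
qed

lemma negligible_vertical_line: "negligible ({c :: real} \<times> (UNIV :: real set))"
proof -
  have "negligible {p :: real \<times> real. (1, 0) \<bullet> p = c}"
    by (rule negligible_hyperplane) (simp add: zero_prod_def)
  then show ?thesis by (rule negligible_subset) (auto simp: inner_prod_def)
qed

text \<open>Replacing \<open>TT N \<alpha>\<close> by its branch of digit \<open>d\<close> on \<open>boxA1\<close> changes the image only over the left edge.
A vertical line is mapped into a vertical line, so the change stays negligible after the next step.\<close>

lemma third_images_agree:
  "negligible (sym_diff (TT N \<alpha> ` TT N \<alpha> ` boxA1) (TT N \<beta> ` boxD2))"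
proof -
  define c where "c = T N \<alpha> b.Q"
  let ?line = "\<lambda>c. {c} \<times> (UNIV :: real set)"
  have TT_line: "TT N \<alpha> ` ?line z \<subseteq> ?line (T N \<alpha> z)" for z
    by (auto simp: TT_def)
  define L where "L = boxA1 \<inter> ?line b.Q"
  define G where "G = boxA1 - ?line b.Q"
  have G: "TT N \<alpha> ` G = branch N d ` G"
  proof (intro image_cong refl TT_box_A(2) disjI1)
    fix p assume "p \<in> G"
    then show "p \<in> boxA1" "b.Q < fst p" by (auto simp: G_def box_defs less_le)
  qed
  have un: "boxA1 = L \<union> G" unfolding L_def G_def by blast
  have branch_A1: "branch N d ` L \<union> branch N d ` G = boxA2"
    using image_A1 by (simp only: un[symmetric] image_Un[symmetric] box_defs)
  have L: "branch N d ` L \<subseteq> ?line b.R"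
    by (auto simp: L_def branch_def b.corner_eqs(3)[symmetric])
  have "TT N \<alpha> ` L \<subseteq> ?line c"
    using TT_line[of b.Q] unfolding L_def c_def by blast
  then have 1: "TT N \<alpha> ` boxA1 \<subseteq> boxA2 \<union> ?line c"
    unfolding un image_Un G branch_A1[symmetric] by blast
  have 2: "boxA2 \<subseteq> TT N \<alpha> ` boxA1 \<union> ?line b.R"
    unfolding un image_Un G branch_A1[symmetric] using L by blast
  have "sym_diff (TT N \<alpha> ` TT N \<alpha> ` boxA1) (TT N \<alpha> ` boxA2) \<subseteq> ?line (T N \<alpha> c) \<union> ?line (T N \<alpha> b.R)"
    using image_mono[OF 1, of "TT N \<alpha>"] image_mono[OF 2, of "TT N \<alpha>"] TT_line[of c] TT_line[of b.R]
    unfolding image_Un by blast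
  moreover have "negligible (?line (T N \<alpha> c) \<union> ?line (T N \<alpha> b.R))"
    by (intro negligible_Un negligible_vertical_line)
  ultimately show ?thesis
    unfolding TT_image_box_2[symmetric] by (rule negligible_subset[rotated])
qed

section \<open>The isomorphism\<close>

text \<open>The two itineraries are \<open>d, d + i, k + 1\<close> and \<open>d + i, d, k\<close>. After two steps the first coordinates are
corners as in \<open>corner_quotient\<close> for \<open>t = x - 1\<close>, and the second coordinates differ by one by \<open>fibre_shift\<close>;
both differences are absorbed by the last digits \<open>k + 1\<close> and \<open>k\<close>.\<close>

lemma branch_conjugacy:
  assumes p: "p \<in> rectD0"
  shows "branch N (k + 1) (branch N (d + i) (branch N d p)) =
    branch N k (branch N d (branch N (d + i) (shift p)))"
proof -
  obtain u v where uv: "p = (u, v)" by fastforce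
  have "u > \<alpha> + 1" "v > 0" using p heights by (auto simp: uv rect_defs)
  have 1: "shift p \<in> rectA0" by (rule kernel_isoD(5)[OF iso_shift p])
  have 2: "branch N (d + i) (shift p) \<in> rectA1" by (rule kernel_isoD(5)[OF iso_A0 1])
  have 3: "branch N d (branch N (d + i) (shift p)) \<in> rectA2" by (rule kernel_isoD(5)[OF iso_A1 2])
  have 4: "branch N d p \<in> rectD1" by (rule kernel_isoD(5)[OF iso_D0 p])
  have "u - 1 > 0" using \<open>u > \<alpha> + 1\<close> corners by simp
  moreover have "rN / (u - 1) - (rd + ri) > 0"
    using 2 corners by (simp add: uv shift_apply branch_def rect_defs)
  moreover have "rN / (u - 1 + 1) - rd > 0"
    using 4 corners by (simp add: uv branch_def rect_defs)
  moreover have "rN / (rN / (u - 1) - (rd + ri)) - rd > 0"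
    using 3 corners by (simp add: uv shift_apply branch_def rect_defs)
  ultimately have "rN / (rN / (rN / u - rd) - (rd + ri)) = rN / (rN / (rN / (u - 1) - (rd + ri)) - rd) + 1"
    using corner_quotient[of "u - 1"] by simp
  moreover note fibre_shift[OF \<open>v > 0\<close>]
  ultimately show ?thesis by (simp add: uv shift_apply branch_def add_ac)
qed

lemma orbit_D:
  assumes p: "p \<in> rectD0"
  shows "TT N \<beta> p \<in> rectD1" "TT N \<beta> (TT N \<beta> p) \<in> rectD2"
    and "shift p \<in> rectA0" "TT N \<alpha> (shift p) \<in> rectA1" "TT N \<alpha> (TT N \<alpha> (shift p)) \<in> rectA2"
    and "TT N \<beta> (TT N \<beta> (TT N \<beta> p)) = TT N \<alpha> (TT N \<alpha> (TT N \<alpha> (shift p)))"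
    and "TT N \<beta> p = branch N d p" "TT N \<beta> (TT N \<beta> p) = branch N (d + i) (TT N \<beta> p)"
    and "TT N \<alpha> (shift p) = branch N (d + i) (shift p)"
      "TT N \<alpha> (TT N \<alpha> (shift p)) = branch N d (TT N \<alpha> (shift p))"
proof -
  show D0: "TT N \<beta> p = branch N d p" using p rect_box TT_box_D(1) by blast
  show D1: "TT N \<beta> p \<in> rectD1" unfolding D0 by (rule kernel_isoD(5)[OF iso_D0 p])
  show D1': "TT N \<beta> (TT N \<beta> p) = branch N (d + i) (TT N \<beta> p)" using D1 rect_box TT_box_D(2) by blast
  show D2: "TT N \<beta> (TT N \<beta> p) \<in> rectD2" unfolding D1' by (rule kernel_isoD(5)[OF iso_D1 D1])
  show A0: "shift p \<in> rectA0" by (rule kernel_isoD(5)[OF iso_shift p])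
  show A0': "TT N \<alpha> (shift p) = branch N (d + i) (shift p)" using A0 rect_box TT_box_A(1) by blast
  show A1: "TT N \<alpha> (shift p) \<in> rectA1" unfolding A0' by (rule kernel_isoD(5)[OF iso_A0 A0])
  have "b.Q < fst (TT N \<alpha> (shift p))" using A1 by (auto simp: rect_defs)
  then show A1': "TT N \<alpha> (TT N \<alpha> (shift p)) = branch N d (TT N \<alpha> (shift p))"
    using A1 rect_box TT_box_A(2) by blast
  show A2: "TT N \<alpha> (TT N \<alpha> (shift p)) \<in> rectA2" unfolding A1' by (rule kernel_isoD(5)[OF iso_A1 A1])
  have "TT N \<beta> (TT N \<beta> (TT N \<beta> p)) = branch N (k + 1) (TT N \<beta> (TT N \<beta> p))"
    using D2 rect_box TT_box_D(3) by blast
  moreover have "TT N \<alpha> (TT N \<alpha> (TT N \<alpha> (shift p))) = branch N k (TT N \<alpha> (TT N \<alpha> (shift p)))"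
    using A2 rect_box TT_box_A(3) by blast
  moreover have "branch N (k + 1) (TT N \<beta> (TT N \<beta> p)) = branch N k (TT N \<alpha> (TT N \<alpha> (shift p)))"
    using branch_conjugacy[OF p] unfolding D0[symmetric] A0'[symmetric]
    unfolding D1'[symmetric] A1'[symmetric] .
  ultimately show "TT N \<beta> (TT N \<beta> (TT N \<beta> p)) = TT N \<alpha> (TT N \<alpha> (TT N \<alpha> (shift p)))"
    by (simp only:)
qed

definition transfer :: "real \<times> real \<Rightarrow> real \<times> real" where
  "transfer p =
     (if p \<in> boxD0 then (TT_inv N d i \<alpha> ^^ 3) ((TT N \<beta> ^^ 3) p)
      else if p \<in> boxD1 then (TT_inv N d i \<alpha> ^^ 2) ((TT N \<beta> ^^ 2) p)
      else if p \<in> boxD2 then TT_inv N d i \<alpha> (TT N \<beta> p)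
      else p)"

text \<open>The triple inverse retraces the orbit of \<open>shift p\<close>, since each of its points is an interior point
of the domain of \<open>\<alpha>\<close>.\<close>

lemma transfer_orbit:
  assumes p: "p \<in> rectD0"
  shows "transfer p = shift p" "transfer (TT N \<beta> p) = TT N \<alpha> (shift p)"
    "transfer (TT N \<beta> (TT N \<beta> p)) = TT N \<alpha> (TT N \<alpha> (shift p))"
proof -
  note o = orbit_D[OF p]
  have inv: "TT_inv N d i \<alpha> (TT N \<alpha> (shift p)) = shift p"
    "TT_inv N d i \<alpha> (TT N \<alpha> (TT N \<alpha> (shift p))) = TT N \<alpha> (shift p)"
    "TT_inv N d i \<alpha> (TT N \<alpha> (TT N \<alpha> (TT N \<alpha> (shift p)))) = TT N \<alpha> (TT N \<alpha> (shift p))"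
    using a.TT_inv_TT o(3-5) rect_interior by blast+
  have x: "a.S \<le> \<alpha> + 1" "b.P \<le> \<alpha> + 1"
    using corners by linarith+
  have 0: "p \<in> boxD0" using p rect_box by blast
  have 1: "TT N \<beta> p \<in> boxD1" "TT N \<beta> p \<notin> boxD0"
    using o(1) rect_box x by (auto simp: rectD1_def boxD0_def)
  have 2: "TT N \<beta> (TT N \<beta> p) \<in> boxD2" "TT N \<beta> (TT N \<beta> p) \<notin> boxD0" "TT N \<beta> (TT N \<beta> p) \<notin> boxD1"
    using o(2) rect_box x heights_order by (auto simp: rectD2_def boxD0_def boxD1_def)
  show "transfer p = shift p" "transfer (TT N \<beta> p) = TT N \<alpha> (shift p)"
    "transfer (TT N \<beta> (TT N \<beta> p)) = TT N \<alpha> (TT N \<alpha> (shift p))"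
    unfolding transfer_def using 0 1 2 by (simp_all add: numeral_2_eq_2 numeral_3_eq_3 o(6) inv)
qed

lemma transfer_common: "p \<in> common \<Longrightarrow> transfer p = p"
  by (simp add: transfer_def common_def)

lemma rectD1_E:
  assumes "p \<in> rectD1"
  obtains q where "q \<in> rectD0" "p = TT N \<beta> q" "branch_inv N d p = q"
proof
  show "branch_inv N d p \<in> rectD0" by (rule kernel_isoD(7)[OF iso_D0 assms])
  then show "p = TT N \<beta> (branch_inv N d p)"
    using orbit_D(7) kernel_isoD(8)[OF iso_D0 assms] by simp
qed simp

lemma rectD2_E:
  assumes "p \<in> rectD2"
  obtains q where "q \<in> rectD0" "p = TT N \<beta> (TT N \<beta> q)" "branch_inv N (d + i) p = TT N \<beta> q"
proof -
  have "branch_inv N (d + i) p \<in> rectD1" by (rule kernel_isoD(7)[OF iso_D1 assms])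
  then obtain q where q: "q \<in> rectD0" "branch_inv N (d + i) p = TT N \<beta> q" by (metis rectD1_E)
  then have "p = TT N \<beta> (TT N \<beta> q)"
    using orbit_D(8)[OF q(1)] kernel_isoD(8)[OF iso_D1 assms] by simp
  then show ?thesis using q that by blast
qed

text \<open>On each rectangle the map is a composition of branches and inverse branches around the square formed
by the planar maps and \<open>shift\<close>.\<close>

lemma transfer_iso:
  "\<exists>f g. kernel_iso N f g (rectD0 \<union> (rectD1 \<union> (rectD2 \<union> common))) (rectA0 \<union> (rectA1 \<union> (rectA2 \<union> common))) \<and>
    (\<forall>p \<in> rectD0 \<union> (rectD1 \<union> (rectD2 \<union> common)). transfer p = f p)"
proof -
  define f1 where "f1 = branch N (d + i) \<circ> (shift \<circ> branch_inv N d)"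
  define f2 where "f2 = branch N d \<circ> (f1 \<circ> branch_inv N (d + i))"
  obtain g1 where iso1: "kernel_iso N f1 g1 rectD1 rectA1"
    unfolding f1_def
    using kernel_iso_compose[OF kernel_iso_compose[OF kernel_iso_inverse[OF iso_D0] iso_shift] iso_A0] by blast
  obtain g2 where iso2: "kernel_iso N f2 g2 rectD2 rectA2"
    unfolding f2_def
    using kernel_iso_compose[OF kernel_iso_compose[OF kernel_iso_inverse[OF iso_D1] iso1] iso_A1] by blast
  have common: "common \<in> sets borel"
  proof -
    have "b.region \<in> sets borel" by (intro borel_closed b.closed_region)
    moreover have "{p. off_grid p} \<in> sets borel"
    proof -
      have "{p. off_grid p} = (- grid_x) \<times> (- grid_y)" by (auto simp: off_grid_def)
      moreover have "- grid_x \<in> sets borel" "- grid_y \<in> sets borel"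
        by (auto intro!: borel_open finite_imp_closed simp: grid_x_def grid_y_def)
      ultimately show ?thesis by (simp add: borel_prod[symmetric])
    qed
    moreover have "boxD0 \<union> boxD1 \<union> boxD2 \<in> sets borel" by (auto simp: box_defs)
    moreover have "common = b.region \<inter> {p. off_grid p} - (boxD0 \<union> boxD1 \<union> boxD2)" by (auto simp: common_def)
    ultimately show ?thesis by (simp only: sets.Diff sets.Int)
  qed
  define f where "f = (\<lambda>p. if p \<in> rectD0 then shift p else if p \<in> rectD1 then f1 p else if p \<in> rectD2 then f2 p else p)"
  obtain g where "kernel_iso N f g (rectD0 \<union> (rectD1 \<union> (rectD2 \<union> common))) (rectA0 \<union> (rectA1 \<union> (rectA2 \<union> common)))"
    unfolding f_def
    using kernel_iso_union[OF iso_shift kernel_iso_union[OF iso1 kernel_iso_union[OF iso2 kernel_iso_id[OF common, of N]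
      rect_disjoint(3,6)] rect_disjoint(2,5)] rect_disjoint(1,4)] by blast
  moreover have "transfer p = f p" if p: "p \<in> rectD0 \<union> (rectD1 \<union> (rectD2 \<union> common))" for p
  proof -
    have f1: "transfer p = f1 p" if "p \<in> rectD1" for p
      using that
    proof (rule rectD1_E)
      fix q assume "q \<in> rectD0" "p = TT N \<beta> q" "branch_inv N d p = q"
      then show ?thesis using transfer_orbit(2) orbit_D(9) by (simp add: f1_def)
    qed
    have f2: "transfer p = f2 p" if "p \<in> rectD2" for p
      using that
    proof (rule rectD2_E)
      fix q assume q: "q \<in> rectD0" "p = TT N \<beta> (TT N \<beta> q)" "branch_inv N (d + i) p = TT N \<beta> q"
      have "f1 (TT N \<beta> q) = TT N \<alpha> (shift q)"
        using f1 transfer_orbit(2) orbit_D(1) q(1) by simp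
      then show ?thesis using q transfer_orbit(3) orbit_D(10) by (simp add: f2_def)
    qed
    show ?thesis
    proof -
      consider "p \<in> rectD0" | "p \<notin> rectD0" "p \<in> rectD1" | "p \<notin> rectD0" "p \<notin> rectD1" "p \<in> rectD2"
        | "p \<notin> rectD0" "p \<notin> rectD1" "p \<notin> rectD2" "p \<in> common"
        using p by blast
      then show ?thesis
        by cases (simp_all add: f_def f1 f2 transfer_common transfer_orbit(1))
    qed
  qed
  ultimately show ?thesis by (intro exI conjI ballI)
qed

lemma rect_region: "rectD0 \<subseteq> b.region" "rectD1 \<subseteq> b.region" "rectD2 \<subseteq> b.region"
  "rectA0 \<subseteq> a.region" "rectA1 \<subseteq> a.region" "rectA2 \<subseteq> a.region"
  using rect_interior a.region_interior_subset b.region_interior_subset by blast+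

text \<open>By injectivity a point of the domain can enter the first or second image of the strip only from the
previous one.\<close>

lemma D_preimages:
  assumes p: "p \<in> b.region"
  shows "TT N \<beta> p \<in> rectD1 \<Longrightarrow> p \<in> rectD0" "TT N \<beta> p \<in> rectD2 \<Longrightarrow> p \<in> rectD1"
proof -
  assume "TT N \<beta> p \<in> rectD1"
  then obtain q where q: "q \<in> rectD0" "TT N \<beta> p = TT N \<beta> q" by (metis rectD1_E)
  then have "q = p" using b.TT_inj_interior[of q p] p rect_interior by auto
  then show "p \<in> rectD0" using q by simp
next
  assume "TT N \<beta> p \<in> rectD2"
  then obtain q where q: "q \<in> rectD0" "TT N \<beta> p = TT N \<beta> (TT N \<beta> q)" by (metis rectD2_E)
  then have "TT N \<beta> q \<in> b.region_interior" using subsetD[OF rect_interior(5) orbit_D(1)] q(1) by simp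
  then have "TT N \<beta> q = p" using b.TT_inj_interior[of "TT N \<beta> q" p] p q(2) by simp
  then show "p \<in> rectD1" using orbit_D(1)[OF q(1)] by simp
qed

text \<open>On \<open>D0\<close> and \<open>D1\<close> both sides are the next point of the orbit of \<open>shift\<close> (\<open>transfer_orbit\<close>). From \<open>D2\<close>
the image is a point of both domains, which is fixed. A point of the common part goes either to the common part, where the two maps
agree, or to \<open>D0\<close>, where the digits differ by one and \<open>shift\<close> corrects this.\<close>

lemma transfer_equivariant:
  assumes p: "p \<in> b.region" "off_grid p" and q: "off_grid (TT N \<beta> p)"
  shows "transfer (TT N \<beta> p) = TT N \<alpha> (transfer p)"
proof -
  have Tp: "TT N \<beta> p \<in> b.region" using b.TT_region p by simp
  consider (D0) "p \<in> rectD0" | (D1) "p \<in> rectD1" | (D2) "p \<in> rectD2" | (common) "p \<in> common"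
    using cover_b[OF p] by blast
  then show ?thesis
  proof cases
    case D0
    then show ?thesis using transfer_orbit by simp
  next
    case D1
    then obtain r where "r \<in> rectD0" "p = TT N \<beta> r" by (rule rectD1_E)
    then show ?thesis using transfer_orbit by simp
  next
    case D2
    then obtain r where r: "r \<in> rectD0" "p = TT N \<beta> (TT N \<beta> r)" by (rule rectD2_E)
    then have eq: "TT N \<beta> p = TT N \<alpha> (transfer p)" and "transfer p \<in> rectA2"
      using orbit_D(5,6) transfer_orbit(3) by simp_all
    then have "TT N \<beta> p \<in> a.region" using a.TT_region[OF subsetD[OF rect_region(6)]] by simp
    then have "TT N \<beta> p \<in> common" using cover_b[OF Tp q] rectD_outside_a by blast
    then show ?thesis using transfer_common eq by simp
  next
    case common
    then have "p \<notin> rectD0" "p \<notin> rectD1" using rect_disjoint(1,2) by blast+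
    then have cover: "TT N \<beta> p \<in> rectD0 \<or> TT N \<beta> p \<in> common"
      using cover_b[OF Tp q] D_preimages[OF p(1)] by blast
    have Ta: "TT N \<alpha> p \<in> a.region" using common common_subset_a a.TT_region by blast
    obtain x y where xy: "p = (x, y)" by fastforce
    define m where "m = digit N \<alpha> x - digit N \<beta> x"
    have T: "T N \<beta> x = T N \<alpha> x + of_int m" by (simp add: T_def m_def)
    have fst: "fst (TT N \<alpha> p) = T N \<alpha> x" "fst (TT N \<beta> p) = T N \<beta> x" by (simp_all add: xy TT_def)
    have Tx: "\<alpha> \<le> T N \<alpha> x" "T N \<alpha> x < \<alpha> + 1" by (rule a.T_bounds)+
    show ?thesis
    proof (cases "TT N \<beta> p \<in> rectD0")
      case True
      then have "\<alpha> + 1 < T N \<beta> x" "T N \<beta> x < \<beta> + 1" by (auto simp: rect_defs fst[symmetric])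
      \<comment> \<open>the images lie in \<open>[\<alpha>, \<alpha> + 1)\<close> and \<open>(\<alpha> + 1, \<beta> + 1)\<close>, where \<open>\<beta> < \<alpha> + 1\<close>; so their
      difference, an integer, is \<open>1\<close>\<close>
      then have "0 < real_of_int m" "real_of_int m < 2" using Tx T corners by linarith+
      then have m: "m = 1" by simp
      have "y > 0" using p(1) A_pos by (auto simp: xy b.region_def)
      moreover have "d \<le> digit N \<beta> x" using p(1) b.digit_range by (auto simp: xy b.region_def)
      ultimately have "of_int (digit N \<beta> x) + y > 0" using d_ge_1 by (simp add: add_pos_pos)
      then have "shift (TT N \<beta> p) = TT N \<alpha> p"
        using T m real_bounds by (simp add: xy TT_def shift_apply m_def)
      then show ?thesis using transfer_orbit(1)[OF True] transfer_common[OF common] by simp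
    next
      case False
      then have TW: "TT N \<beta> p \<in> common" using cover by blast
      then have "TT N \<beta> p \<in> a.region" using common_subset_a by blast
      then have "\<alpha> \<le> T N \<beta> x" "T N \<beta> x \<le> \<alpha> + 1" by (auto simp: a.region_def fst[symmetric])
      moreover have "T N \<beta> x \<noteq> \<alpha> + 1" using q by (auto simp: off_grid_def grid_x_def fst)
      ultimately have "-1 < real_of_int m" "real_of_int m < 1" using Tx T by linarith+
      then have "m = 0" by linarith
      then have "TT N \<beta> p = TT N \<alpha> p" by (simp add: xy TT_def T_def m_def)
      then show ?thesis using transfer_common[OF common] transfer_common[OF TW] by simp
    qed
  qed
qed

theorem transfer_metric_isomorphism:
  "metric_isomorphism (mu N d i \<beta>) (TT N \<beta>) (mu N d i \<alpha>) (TT N \<alpha>) transfer"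
proof -
  have countable: "countable grid_x" "countable grid_y" by (simp_all add: grid_x_def grid_y_def)
  have off: "AE p in lborel. off_grid p"
    using AE_off_countable_lines[OF countable] by (simp add: off_grid_def)
  have off_T: "AE p in lborel. off_grid (TT N \<beta> p)"
    using AE_TT_off_countable_lines[OF _ countable] N_pos by (simp add: off_grid_def)
  from transfer_iso obtain f g where
    iso: "kernel_iso N f g (rectD0 \<union> (rectD1 \<union> (rectD2 \<union> common))) (rectA0 \<union> (rectA1 \<union> (rectA2 \<union> common)))"
    and f: "\<forall>p \<in> rectD0 \<union> (rectD1 \<union> (rectD2 \<union> common)). transfer p = f p"
    by (elim exE conjE)
  show ?thesis
    unfolding mu_eq_normalized a.Omega_eq b.Omega_eq
  proof (rule metric_isomorphism_normalized_kernel[OF _ _ _ iso _ _ _ _ bspec[OF f]])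
    show "b.region \<in> sets borel" "a.region \<in> sets borel"
      by (intro borel_closed a.closed_region b.closed_region)+
    show "rectD0 \<union> (rectD1 \<union> (rectD2 \<union> common)) \<subseteq> b.region"
      using rect_region by (auto simp: common_def)
    show "rectA0 \<union> (rectA1 \<union> (rectA2 \<union> common)) \<subseteq> a.region"
      using rect_region common_subset_a by blast
    show "AE p in lborel. p \<in> b.region \<longrightarrow> p \<in> rectD0 \<union> (rectD1 \<union> (rectD2 \<union> common))"
      using off by eventually_elim (use cover_b in blast)
    show "AE p in lborel. p \<in> a.region \<longrightarrow> p \<in> rectA0 \<union> (rectA1 \<union> (rectA2 \<union> common))"
      using off by eventually_elim (use cover_a in blast)
    show "AE p in lborel. p \<in> b.region \<longrightarrow> transfer (TT N \<beta> p) = TT N \<alpha> (transfer p)"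
      using off off_T by eventually_elim (use transfer_equivariant in blast)
  qed (use N_pos in auto)
qed

end

theorem proposition3:
  fixes N d i k :: int and \<alpha> \<beta> :: real
    and A0 A1 A2 D0 D1 D2 :: "(real \<times> real) set"
    and M :: "real \<times> real \<Rightarrow> real \<times> real"
  defines "A0 \<equiv> {\<alpha>..\<beta>} \<times> {hA N d i..hD N d}"
    and "A1 \<equiv> TT N \<alpha> ` A0"
    and "A2 \<equiv> TT N \<alpha> ` A1"
    and "D0 \<equiv> {\<alpha> + 1..\<beta> + 1} \<times> {hC N d i..hF N d}"
    and "D1 \<equiv> TT N \<beta> ` D0"
    and "D2 \<equiv> TT N \<beta> ` D1"
    and "M \<equiv> \<lambda>p.
       if p \<in> D0 then (TT_inv N d i \<alpha> ^^ 3) ((TT N \<beta> ^^ 3) p)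
       else if p \<in> D1 then (TT_inv N d i \<alpha> ^^ 2) ((TT N \<beta> ^^ 2) p)
       else if p \<in> D2 then TT_inv N d i \<alpha> (TT N \<beta> p)
       else p"
  assumes "N \<ge> 2" and "d \<ge> 1" and "i \<ge> 2"
    and "real_of_int N = real_of_int (d * (d + i)) / real_of_int (i - 1)"
    and "k \<in> {d..d + i - 1}"
    and "\<alpha> \<in> Xk N d i k" and "\<beta> \<in> Xk N d i k" and "\<alpha> < \<beta>"
    and "T N \<alpha> (T N \<alpha> \<alpha>) \<in> interior (cylinder N \<alpha> k)"
    and "T N \<alpha> (T N \<alpha> (\<alpha> + 1)) \<in> interior (cylinder N \<alpha> (k + 1))"
    and "T N \<beta> (T N \<beta> \<beta>) \<in> interior (cylinder N \<beta> k)"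
    and "T N \<beta> (T N \<beta> (\<beta> + 1)) \<in> interior (cylinder N \<beta> (k + 1))"
    and A0_in_domain: "A0 \<subseteq> \<Omega> N d i \<alpha>"
    and D0_in_domain: "D0 \<subseteq> \<Omega> N d i \<beta>"
  shows "negligible (sym_diff (TT N \<alpha> ` A2) (TT N \<beta> ` D2)) \<and>
         (T N \<beta> (T N \<beta> \<beta>) \<noteq> \<alpha> + 1 \<longrightarrow> TT N \<alpha> ` A2 = TT N \<beta> ` D2) \<and>
         metric_isomorphism (mu N d i \<beta>) (TT N \<beta>) (mu N d i \<alpha>) (TT N \<alpha>) M"
proof -
  interpret parameters N d i
  proof
    show "real_of_int N * (real_of_int i - 1) = real_of_int d * (real_of_int d + real_of_int i)"
      using assms(10,11) by simp
  qed fact+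
  interpret a: interval_map N d i k \<alpha>
    using assms by unfold_locales auto
  interpret b: interval_map N d i k \<beta>
    using assms by unfold_locales auto
  have "(\<beta>, A) \<in> a.region"
    using A0_in_domain \<open>\<alpha> < \<beta>\<close> heights_order by (auto simp: A0_def a.Omega_eq)
  then have "\<beta> \<le> a.P" using heights_order by (force simp: a.region_def)
  moreover have "(\<alpha> + 1, F) \<in> b.region"
    using D0_in_domain \<open>\<alpha> < \<beta>\<close> heights_order by (auto simp: D0_def b.Omega_eq)
  then have "b.R \<le> \<alpha> + 1" using heights_order by (force simp: b.region_def)
  ultimately interpret interval_map_pair N d i k \<alpha> \<beta>
    using \<open>\<alpha> < \<beta>\<close> by unfold_locales
  have box: "A0 = boxA0" "A1 = boxA1" "D0 = boxD0" "D1 = boxD1" "D2 = boxD2"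
    by (simp_all add: A0_def A1_def D0_def D1_def D2_def TT_image_box_D TT_image_box_A0
        boxA0_def[symmetric] boxD0_def[symmetric])
  have "M = transfer" by (simp add: M_def transfer_def box fun_eq_iff)
  moreover have "TT N \<alpha> ` A2 = TT N \<beta> ` D2" if "b.R \<noteq> \<alpha> + 1"
    unfolding A2_def box TT_image_box_A1[OF that] by (rule TT_image_box_2)
  ultimately show ?thesis
    using third_images_agree transfer_metric_isomorphism by (simp add: A2_def box)
qed

end
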